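(* Let $\{\Omega_1,\ldots,\Omega_n,\bar x\}$ be an extremal system in an Asplund space $X$, where the sets $\Omega_i\subset X$ are locally closed around $\bar x$. Then for any $\varepsilon>0$ there exist points $$x_i\in\Omega_i\quad\text{with}\quad\|x_i-\bar x\|\le\varepsilon,\qquad i=1,\ldots,n,$$ and dual elements $x^*_i\in X^*$, $i=1,\ldots,n$, which are the rates of change of the linear utility functions $u_{x^*_i}(x):=\langle x^*_i,x\rangle$, satisfying $$x^*_1+\ldots+x^*_n=0\quad\text{and}\quad\|x^*_1\|+\ldots+\|x^*_n\|=1,$$ such that, for each $i=1,\ldots,n$, the point $x_i$ is a local stationary trap relative to $\Omega_i$ with respect to the linear utility function $u_{x^*_i}$ for any weight factor $\xi>\varepsilon$.
   Context: A Banach space is Asplund if each of its separable subspaces has a separable dual. Extremal system: $\bar x$ is a locally extremal point of the finitely many sets $\Omega_1,\ldots,\Omega_n$ in a normed space $X$, and $\{\Omega_1,\ldots,\Omega_n,\bar x\}$ is called an extremal system, if (a) $\bar x\in\Omega_i$ for all $i=1,\ldots,n$; and (b) there exist a neighborhood $V$ of $\bar x$ and sequences $\{a_{ik}\}_k\subset X$, $i=1,\ldots,n$, with $a_{ik}\to 0$ as $k\to\infty$ for each $i$, such that $\bigcap_{i=1}^n(\Omega_i-a_{ik})\cap V=\emptyset$ for all large natural numbers $k$. Local stationary trap: for $z\in\Omega\subset X$, $x^*\in X^*$ and $\xi\ge 0$, the point $z$ is a local stationary trap relative to $\Omega$ with respect to the utility function $u_{x^*}(x)=\langle x^*,x\rangle$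 with the weight factor $\xi$ if there is a neighborhood $V(z)$ of $z$ such that $u_{x^*}(x)-\xi\|x-z\|\le u_{x^*}(z)$ for all $x\in V(z)\cap\Omega$. "For any weight factor $\xi>\varepsilon$" means that this holds for every $\xi>\varepsilon$, with the neighborhood allowed to depend on $\xi$. *)

theory Defs
  imports "HOL-Analysis.Analysis"
begin

text \<open>
  A subspace \<open>Y\<close> is a set, not a type, so its dual cannot be a \<open>blinfun\<close> type. It is the set of
  bounded linear functionals on \<open>Y\<close>, made unique as HOL functions by being \<open>undefined\<close> off \<open>Y\<close>,
  and it carries the metric of the dual norm, the supremum over the unit ball of \<open>Y\<close>. The value
  0 off the dual is there because \<open>Metric_space\<close> demands nonnegative values everywhere.
\<close>

definition dual_on :: "'a::real_normed_vector set \<Rightarrow> ('a \<Rightarrow> real) set" where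
  "dual_on Y = {f \<in> extensional Y.
     (\<forall>x\<in>Y. \<forall>y\<in>Y. f (x + y) = f x + f y) \<and>
     (\<forall>c. \<forall>x\<in>Y. f (c *\<^sub>R x) = c * f x) \<and>
     (\<exists>B. \<forall>x\<in>Y. \<bar>f x\<bar> \<le> B * norm x)}"

definition dual_dist :: "'a::real_normed_vector set \<Rightarrow> ('a \<Rightarrow> real) \<Rightarrow> ('a \<Rightarrow> real) \<Rightarrow> real" where
  "dual_dist Y f g =
     (if f \<in> dual_on Y \<and> g \<in> dual_on Y
      then SUP x\<in>{x\<in>Y. norm x \<le> 1}. \<bar>f x - g x\<bar> else 0)"

lemma dual_dist_bdd_above:
  assumes "f \<in> dual_on Y" "g \<in> dual_on Y"
  shows "bdd_above ((\<lambda>x. \<bar>f x - g x\<bar>) ` {x\<in>Y. norm x \<le> 1})"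
proof -
  obtain B C where B: "\<And>x. x \<in> Y \<Longrightarrow> \<bar>f x\<bar> \<le> B * norm x"
    and C: "\<And>x. x \<in> Y \<Longrightarrow> \<bar>g x\<bar> \<le> C * norm x"
    using assms unfolding dual_on_def by blast
  have "\<bar>f x - g x\<bar> \<le> \<bar>B\<bar> + \<bar>C\<bar>" if "x \<in> Y" "norm x \<le> 1" for x
  proof -
    have "B * norm x \<le> \<bar>B\<bar> * 1" "C * norm x \<le> \<bar>C\<bar> * 1"
      using that by (intro mult_mono; simp)+
    then show ?thesis using B[OF that(1)] C[OF that(1)] by linarith
  qed
  then show ?thesis by (auto intro!: bdd_aboveI2)
qed

lemma Metric_space_dual:
  assumes Y: "subspace (Y :: 'a::real_normed_vector set)"
  shows "Metric_space (dual_on Y) (dual_dist Y)"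
proof
  let ?B = "{x\<in>Y. norm x \<le> 1}"
  have zero: "0 \<in> ?B" using Y by (simp add: subspace_0)
  have upper: "\<bar>f x - g x\<bar> \<le> dual_dist Y f g"
    if "f \<in> dual_on Y" "g \<in> dual_on Y" "x \<in> ?B" for f g x
    using cSUP_upper[OF that(3) dual_dist_bdd_above[OF that(1,2)]] that
    by (simp add: dual_dist_def)
  have least: "dual_dist Y f g \<le> c"
    if "f \<in> dual_on Y" "g \<in> dual_on Y" "\<And>x. x \<in> ?B \<Longrightarrow> \<bar>f x - g x\<bar> \<le> c" for f g c
    using that zero by (auto simp: dual_dist_def intro!: cSUP_least)
  show "0 \<le> dual_dist Y f g" for f g
  proof (cases "f \<in> dual_on Y \<and> g \<in> dual_on Y")
    case True
    then show ?thesis using upper[OF _ _ zero, of f g] by linarith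
  qed (auto simp: dual_dist_def)
  then have nonneg: "0 \<le> dual_dist Y f g" for f g .
  show "dual_dist Y f g = dual_dist Y g f" for f g
    by (auto simp: dual_dist_def abs_minus_commute)
  show "dual_dist Y f g = 0 \<longleftrightarrow> f = g" if f: "f \<in> dual_on Y" and g: "g \<in> dual_on Y" for f g
  proof
    assume "f = g"
    then have "dual_dist Y f g \<le> 0" using f g by (intro least) auto
    then show "dual_dist Y f g = 0" using nonneg[of f g] by linarith
  next
    assume 0: "dual_dist Y f g = 0"
    show "f = g"
    proof (rule extensionalityI[of _ Y])
      show "f \<in> extensional Y" "g \<in> extensional Y" using f g by (auto simp: dual_on_def)
      fix x assume x: "x \<in> Y"
      define c where "c = inverse (norm x + 1)"
      have c: "c > 0" by (simp add: c_def add_nonneg_pos)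
      have "norm (c *\<^sub>R x) \<le> 1"
        using norm_ge_zero[of x] by (simp add: c_def divide_simps not_less)
      then have "c *\<^sub>R x \<in> ?B" using x Y by (simp add: subspace_scale)
      then have "f (c *\<^sub>R x) = g (c *\<^sub>R x)" using upper[OF f g] 0 by force
      moreover have "f (c *\<^sub>R x) = c * f x" "g (c *\<^sub>R x) = c * g x"
        using f g x by (auto simp: dual_on_def)
      ultimately show "f x = g x" using c by simp
    qed
  qed
  show "dual_dist Y f h \<le> dual_dist Y f g + dual_dist Y g h"
    if f: "f \<in> dual_on Y" and g: "g \<in> dual_on Y" and h: "h \<in> dual_on Y" for f g h
  proof (rule least[OF f h])
    fix x assume "x \<in> ?B"
    then show "\<bar>f x - h x\<bar> \<le> dual_dist Y f g + dual_dist Y g h"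
      using upper[OF f g, of x] upper[OF g h, of x] by linarith
  qed
qed

definition asplund_space :: "'a::banach itself \<Rightarrow> bool" where
  "asplund_space _ \<longleftrightarrow>
     (\<forall>Y :: 'a set. subspace Y \<and> separable_space (top_of_set Y) \<longrightarrow>
        separable_space (Metric_space.mtopology (dual_on Y) (dual_dist Y)))"

text \<open>Below, a neighborhood of a point is any set with that point in its interior.\<close>

definition locally_closed_around :: "'a::topological_space set \<Rightarrow> 'a \<Rightarrow> bool" where
  "locally_closed_around \<Omega> x \<longleftrightarrow> (\<exists>U. x \<in> interior U \<and> closed (\<Omega> \<inter> U))"

text \<open>The sets \<open>\<Omega> 1, \<dots>, \<Omega> n\<close> are the values of \<open>\<Omega>\<close> on \<open>{1..n}\<close>; other values are irrelevant.\<close>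

definition extremal_system :: "nat \<Rightarrow> (nat \<Rightarrow> 'a::real_normed_vector set) \<Rightarrow> 'a \<Rightarrow> bool" where
  "extremal_system n \<Omega> xbar \<longleftrightarrow>
     (\<forall>i\<in>{1..n}. xbar \<in> \<Omega> i) \<and>
     (\<exists>V (a :: nat \<Rightarrow> nat \<Rightarrow> 'a). xbar \<in> interior V \<and>
        (\<forall>i\<in>{1..n}. a i \<longlonglongrightarrow> 0) \<and>
        (\<forall>\<^sub>F k in sequentially. (\<Inter>i\<in>{1..n}. (\<lambda>x. x - a i k) ` \<Omega> i) \<inter> V = {}))"

definition local_stationary_trap ::
  "('a::real_normed_vector \<Rightarrow> real) \<Rightarrow> 'a set \<Rightarrow> 'a \<Rightarrow> real \<Rightarrow> bool" where
  "local_stationary_trap u \<Omega> z \<xi> \<longleftrightarrow> z \<in> \<Omega> \<and> \<xi> \<ge> 0 \<and>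
     (\<exists>V. z \<in> interior V \<and> (\<forall>x \<in> V \<inter> \<Omega>. u x - \<xi> * norm (x - z) \<le> u z))"

end

theory Submission
  imports Defs "HOL-Library.Function_Algebras"
begin

text \<open>
  Suppose first that the whole space is a separable subspace \<open>Y\<close> with separable dual. Countably many
  functionals \<open>G m\<close> are then \<open>\<kappa>\<close>-dense in the dual unit ball, and the supremum of all functionals of
  the ball that are \<open>\<kappa>\<close>-close to \<open>G m\<close> is a sublinear function that is Frechet superdifferentiable up to
  an error \<open>\<kappa>\<close>. A locally finite sum of smooth functions of these yields, on the open unit ball, a
  bump whose approximate derivatives are bounded below relative to the error; no smooth renorming
  is needed. If \<open>r\<close> is the smallest scale at which the bump of
  \<open>(x\<^sub>i - a\<^sub>i - (x\<^sub>n - a\<^sub>n)) / r\<close>, summed over \<open>i\<close>, is at most \<open>1/2\<close>, then extremality says that this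
  scale is positive, and Ekeland's principle applied to it produces the points \<open>x\<^sub>i\<close>; the derivatives
  of the bump are the functionals.

  In general, whether such functionals exist at given points is, by the Hahn-Banach theorem, a
  condition on finite subsets of the sets \<open>\<Omega>\<^sub>i\<close> that is stable under small perturbations of the points.
  Hence there is a separable \<open>Y\<close> that contains witnesses for every failure of the condition at points
  of \<open>Y\<close>, and the functionals found on \<open>Y\<close> give functionals for the whole sets.
\<close>

section \<open>Hahn-Banach and Ekeland\<close>

text \<open>The scalar multiplication is a parameter because the Hahn-Banach theorem is applied both
  to a normed space and to families of vectors with pointwise operations.\<close>

definition sublinear :: "(real \<Rightarrow> 'b::ab_group_add \<Rightarrow> 'b) \<Rightarrow> ('b \<Rightarrow> real) \<Rightarrow> bool" where
  "sublinear scl p \<longleftrightarrow>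
     (\<forall>x y. p (x + y) \<le> p x + p y) \<and> (\<forall>c x. c > 0 \<longrightarrow> p (scl c x) \<le> c * p x)"

context
  fixes scl :: "real \<Rightarrow> 'b::ab_group_add \<Rightarrow> 'b"
  assumes vs: "vector_space scl"
begin

interpretation vector_space scl by (fact vs)

lemma sublinear_add: "sublinear scl p \<Longrightarrow> p (x + y) \<le> p x + p y"
  by (simp add: sublinear_def)

lemma sublinear_zero:
  assumes "sublinear scl p"
  shows "p 0 = 0"
proof -
  have "p 0 \<le> p 0 + p 0"
    using sublinear_add[OF assms, of 0 0] by simp
  moreover have "p (scl (1/2) 0) \<le> 1/2 * p 0"
    using assms unfolding sublinear_def by (metis half_gt_zero zero_less_one)
  ultimately show ?thesis by simp
qed

lemma sublinear_scale:
  assumes p: "sublinear scl p" and c: "c \<ge> 0"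
  shows "p (scl c x) = c * p x"
proof (cases "c = 0")
  case True
  then show ?thesis by (simp add: sublinear_zero[OF p])
next
  case False
  then have c: "c > 0" using c by simp
  have "p (scl (1/c) (scl c x)) \<le> 1/c * p (scl c x)"
    using p c unfolding sublinear_def by (metis zero_less_divide_1_iff)
  then have "c * p x \<le> p (scl c x)" using c by (simp add: field_simps)
  then show ?thesis using p c unfolding sublinear_def by (meson antisym)
qed

lemma sublinear_ge: "sublinear scl p \<Longrightarrow> - p (- x) \<le> p x"
  using sublinear_add[of p x "-x"] sublinear_zero[of p] by simp

text \<open>The infimum of \<open>q (x + scl t a) - t * q a\<close> over \<open>t \<ge> 0\<close>
  works. At \<open>x = - a\<close> the second bound reads \<open>r (- a) \<le> - q a\<close>, so
  \<open>r\<close> is linear along \<open>a\<close>. A minimal \<open>q\<close> coincides with its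
  \<open>r\<close> at every \<open>a\<close>, and is therefore additive.\<close>

lemma sublinear_linearize_at:
  assumes q: "sublinear scl q"
  obtains r where "sublinear scl r" "\<And>x. r x \<le> q x" "\<And>x. r x \<le> q (x + a) - q a"
proof
  define r where "r x = (INF t\<in>{0..}. q (x + scl t a) - t * q a)" for x
  have lb: "- q (- x) \<le> q (x + scl t a) - t * q a" if "t \<ge> 0" for x t
    using sublinear_add[OF q, of "x + scl t a" "- x"] sublinear_scale[OF q that, of a] by simp
  have bdd: "bdd_below ((\<lambda>t. q (x + scl t a) - t * q a) ` {0..})" for x
    using lb by (auto intro!: bdd_belowI2)
  have upper: "r x \<le> q (x + scl t a) - t * q a" if "t \<ge> 0" for x t
    unfolding r_def using that by (intro cINF_lower[OF bdd]) auto
  show "r x \<le> q x" for x using upper[of 0 x] by simp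
  show "r x \<le> q (x + a) - q a" for x using upper[of 1 x] by simp
  show "sublinear scl r"
    unfolding sublinear_def
  proof (intro conjI allI impI)
    fix x y
    have "r (x + y) - (q (y + scl t a) - t * q a) \<le> q (x + scl s a) - s * q a"
      if "s \<ge> 0" "t \<ge> 0" for s t
    proof -
      have "x + y + scl (s + t) a = (x + scl s a) + (y + scl t a)"
        by (simp add: scale_left_distrib algebra_simps)
      then show ?thesis
        using upper[of "s + t" "x + y"] that sublinear_add[OF q, of "x + scl s a" "y + scl t a"]
        by (simp add: algebra_simps)
    qed
    then have "r (x + y) - (q (y + scl t a) - t * q a) \<le> r x" if "t \<ge> 0" for t
      using that unfolding r_def[of x] by (intro cINF_greatest) auto
    then have "r (x + y) - r x \<le> q (y + scl t a) - t * q a" if "t \<ge> 0" for t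
      using that by (simp add: algebra_simps)
    then have "r (x + y) - r x \<le> r y"
      unfolding r_def[of y] by (intro cINF_greatest) auto
    then show "r (x + y) \<le> r x + r y" by simp
  next
    fix c :: real and x assume c: "c > 0"
    have "r (scl c x) / c \<le> q (x + scl t a) - t * q a" if "t \<ge> 0" for t
    proof -
      have "r (scl c x) \<le> q (scl c x + scl (c * t) a) - (c * t) * q a"
        using that c by (intro upper) auto
      also have "scl c x + scl (c * t) a = scl c (x + scl t a)"
        by (simp add: scale_right_distrib)
      also have "q \<dots> = c * q (x + scl t a)"
        using c by (intro sublinear_scale[OF q]) auto
      finally show ?thesis
        using c by (simp add: field_simps)
    qed
    then have "r (scl c x) / c \<le> r x"
      unfolding r_def[of x] by (intro cINF_greatest) auto
    then show "r (scl c x) \<le> c * r x" using c by (simp add: field_simps)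
  qed
qed

text \<open>Zorn's lemma with the order reversed. The pointwise infimum of a chain is finite because
  every sublinear \<open>q \<le> p\<close> satisfies \<open>- p (- x) \<le> q x\<close>; it is
  subadditive because any two members of the chain are comparable.\<close>

lemma minimal_sublinear:
  assumes p: "sublinear scl p"
  obtains q where "sublinear scl q" "q \<le> p" "\<And>r. sublinear scl r \<Longrightarrow> r \<le> q \<Longrightarrow> r = q"
proof -
  define A where "A = {q. sublinear scl q \<and> q \<le> p}"
  have "\<exists>m\<in>A. \<forall>a\<in>A. a \<le> m \<longrightarrow> a = m"
  proof (rule predicate_Zorn)
    show "partial_order_on A (relation_of (\<lambda>x y. y \<le> x) A)"
      by (rule partial_order_on_relation_ofI) auto
    fix C assume C: "C \<in> Chains (relation_of (\<lambda>x y. y \<le> x) A)"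
    have CA: "C \<subseteq> A" using C by (auto simp: Chains_def relation_of_def)
    have chain: "q \<le> r \<or> r \<le> q" if "q \<in> C" "r \<in> C" for q r
      using C that by (auto simp: Chains_def relation_of_def)
    show "\<exists>u\<in>A. \<forall>a\<in>C. u \<le> a"
    proof (cases "C = {}")
      case True
      then show ?thesis using p by (auto simp: A_def)
    next
      case False
      define u where "u x = (INF q\<in>C. q x)" for x
      have "- p (- x) \<le> q x" if "q \<in> C" for q x
      proof -
        have "sublinear scl q" "q (- x) \<le> p (- x)" using CA that by (auto simp: A_def le_fun_def)
        then show ?thesis using sublinear_ge[of q x] by linarith
      qed
      then have bdd: "bdd_below ((\<lambda>q. q x) ` C)" for x
        by (auto intro!: bdd_belowI2)
      have upper: "u x \<le> q x" if "q \<in> C" for q x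
        unfolding u_def using that by (intro cINF_lower[OF bdd]) auto
      have "sublinear scl u"
        unfolding sublinear_def
      proof (intro conjI allI impI)
        fix x y
        have *: "u (x + y) \<le> q x + r y" if "q \<in> C" "r \<in> C" for q r
        proof -
          have "\<exists>s\<in>C. s \<le> q \<and> s \<le> r" using chain[OF that] that by blast
          then obtain s where s: "s \<in> C" "s \<le> q" "s \<le> r" by blast
          then have "s (x + y) \<le> s x + s y" using CA by (auto simp: A_def intro: sublinear_add)
          moreover have "s x \<le> q x" "s y \<le> r y" using s by (auto simp: le_fun_def)
          ultimately show ?thesis using upper[OF s(1), of "x + y"] by linarith
        qed
        have "u (x + y) - r y \<le> u x" if "r \<in> C" for r
          unfolding u_def[of x] using *[OF _ that] False by (intro cINF_greatest) (auto simp: algebra_simps)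
        then have "u (x + y) - u x \<le> r y" if "r \<in> C" for r
          using that by (simp add: algebra_simps)
        then have "u (x + y) - u x \<le> u y"
          unfolding u_def[of y] using False by (intro cINF_greatest) auto
        then show "u (x + y) \<le> u x + u y" by simp
      next
        fix c :: real and x assume c: "c > 0"
        have "u (scl c x) / c \<le> q x" if "q \<in> C" for q
        proof -
          have "q (scl c x) = c * q x" using that CA c by (intro sublinear_scale) (auto simp: A_def)
          then show ?thesis using upper[OF that, of "scl c x"] c by (simp add: field_simps)
        qed
        then have "u (scl c x) / c \<le> u x"
          unfolding u_def[of x] using False by (intro cINF_greatest) auto
        then show "u (scl c x) \<le> c * u x" using c by (simp add: field_simps)
      qed
      moreover have "u \<le> p"
      proof -
        from False obtain q where q: "q \<in> C" by blast
        then have "q \<le> p" using CA by (auto simp: A_def)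
        then show ?thesis using upper[OF q] by (auto simp: le_fun_def intro: order_trans)
      qed
      ultimately show ?thesis using upper by (auto simp: A_def le_fun_def)
    qed
  qed
  then obtain q where q: "q \<in> A" "\<And>a. a \<in> A \<Longrightarrow> a \<le> q \<Longrightarrow> a = q" by blast
  then show ?thesis by (intro that[of q]) (auto simp: A_def)
qed

text \<open>A minimal sublinear function is linear, since linearizing it at any point cannot lower
  it. Linearizing \<open>p\<close> at \<open>a\<close> beforehand gives
  \<open>f (- a) \<le> - p a\<close>, which together with \<open>f a \<le> p a\<close> is equality
  at \<open>a\<close>.\<close>

theorem hahn_banach:
  assumes p: "sublinear scl p"
  obtains f where "\<And>x y. f (x + y) = f x + f y" "\<And>c x. f (scl c x) = c * f x"
    "\<And>x. f x \<le> p x" "f a = p a"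
proof -
  obtain p' where p': "sublinear scl p'" "\<And>x. p' x \<le> p x" "\<And>x. p' x \<le> p (x + a) - p a"
    using sublinear_linearize_at[OF p, of a] by blast
  obtain f where f: "sublinear scl f" "f \<le> p'" "\<And>r. sublinear scl r \<Longrightarrow> r \<le> f \<Longrightarrow> r = f"
    using minimal_sublinear[OF p'(1)] by blast
  have add: "f (x + y) = f x + f y" for x y
  proof (rule antisym[OF sublinear_add[OF f(1)]])
    obtain r where r: "sublinear scl r" "\<And>x. r x \<le> f x" "\<And>x. r x \<le> f (x + y) - f y"
      using sublinear_linearize_at[OF f(1), of y] by blast
    then have "r = f" by (intro f) (auto simp: le_fun_def)
    then show "f x + f y \<le> f (x + y)" using r(3)[of x] by simp
  qed
  have minus: "f (- x) = - f x" for x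
    using add[of x "- x"] sublinear_zero[OF f(1)] by simp
  have hom: "f (scl c x) = c * f x" for c x
  proof (cases "c \<ge> 0")
    case True
    then show ?thesis by (rule sublinear_scale[OF f(1)])
  next
    case False
    then have "f (scl (- c) x) = - c * f x" by (intro sublinear_scale[OF f(1)]) auto
    then show ?thesis using minus[of "scl c x"] by simp
  qed
  have le: "f x \<le> p x" for x
  proof -
    have "f x \<le> p' x" using f(2) by (simp add: le_fun_def)
    then show ?thesis using p'(2)[of x] by linarith
  qed
  have "f (- a) \<le> p' (- a)" using f(2) by (simp add: le_fun_def)
  then have "- f a \<le> p (- a + a) - p a" using p'(3)[of "- a"] minus[of a] by linarith
  then have "f a = p a" using le[of a] sublinear_zero[OF p] by simp
  with add hom le show ?thesis using that by blast
qed

end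

lemma norming_functional:
  fixes z :: "'a::real_normed_vector"
  obtains F :: "'a \<Rightarrow>\<^sub>L real" where "norm F \<le> 1" "blinfun_apply F z = norm z"
proof -
  have vs: "vector_space (scaleR :: real \<Rightarrow> 'a \<Rightarrow> 'a)" by unfold_locales
  have "sublinear scaleR (norm :: 'a \<Rightarrow> real)"
    by (auto simp: sublinear_def norm_triangle_ineq)
  from hahn_banach[OF vs this, of z] obtain f :: "'a \<Rightarrow> real" where f: "\<And>x y. f (x + y) = f x + f y"
    "\<And>c x. f (c *\<^sub>R x) = c * f x" "\<And>x. f x \<le> norm x" "f z = norm z" by blast
  have abs: "\<bar>f x\<bar> \<le> norm x" for x using f(3)[of x] f(3)[of "- x"] f(2)[of "-1" x] by simp
  have bl: "bounded_linear f"
    by (rule bounded_linear_intro[of _ 1]) (use f abs in auto)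
  have ap: "blinfun_apply (Blinfun f) = f" by (rule bounded_linear_Blinfun_apply[OF bl])
  show ?thesis
    by (rule that[of "Blinfun f"]) (auto simp: ap f(4) abs intro!: norm_blinfun_bound)
qed

section \<open>Ekeland's variational principle\<close>

text \<open>The function \<open>d\<close> may vanish between different points: in the application
  the points are pairs of a family and a scale, \<open>d\<close> sees only the family, and
  \<open>\<phi>\<close> is the scale. Hence completeness and lower semicontinuity are merged into
  one assumption about Cauchy sequences along which \<open>\<phi>\<close> decreases. The point is
  the limit of almost minimizers chosen successively in the nested sets \<open>L\<close>.\<close>

lemma ekeland:
  fixes d :: "'b \<Rightarrow> 'b \<Rightarrow> real" and \<phi> :: "'b \<Rightarrow> real"
  assumes nonneg: "\<And>x y. d x y \<ge> 0" and refl: "\<And>x. d x x = 0"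
    and tri: "\<And>x y z. d x z \<le> d x y + d y z"
    and \<eta>: "\<eta> > 0"
    and bdd: "\<And>x. x \<in> S \<Longrightarrow> \<phi> x \<ge> 0"
    and complete: "\<And>u. (\<And>k. u k \<in> S) \<Longrightarrow> decseq (\<lambda>k. \<phi> (u k)) \<Longrightarrow>
        (\<And>e. e > 0 \<Longrightarrow> \<exists>K. \<forall>k\<ge>K. \<forall>j\<ge>k. d (u k) (u j) < e) \<Longrightarrow>
        \<exists>x\<in>S. (\<lambda>k. d (u k) x) \<longlonglongrightarrow> 0 \<and> (\<forall>k. \<phi> x \<le> \<phi> (u k))"
    and x0: "x0 \<in> S"
  obtains x where "x \<in> S" "\<phi> x + \<eta> * d x0 x \<le> \<phi> x0" "\<And>y. y \<in> S \<Longrightarrow> \<phi> y \<ge> \<phi> x - \<eta> * d x y"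
proof -
  define L where "L x = {y\<in>S. \<phi> y + \<eta> * d x y \<le> \<phi> x}" for x
  have Lself: "x \<in> L x" if "x \<in> S" for x using that refl by (simp add: L_def)
  have Ltrans: "z \<in> L x" if "y \<in> L x" "z \<in> L y" for x y z
  proof -
    have "\<eta> * d x z \<le> \<eta> * d x y + \<eta> * d y z"
      using mult_left_mono[OF tri[of x z y], of \<eta>] \<eta> by (simp add: distrib_left)
    then show ?thesis using that by (auto simp: L_def)
  qed
  have "\<exists>y. y \<in> L x \<and> (\<forall>z\<in>L x. \<phi> y \<le> \<phi> z + (1/2)^k)" if "x \<in> S" for x k
  proof -
    have ne: "\<phi> ` L x \<noteq> {}" and b: "bdd_below (\<phi> ` L x)"
      using Lself[OF that] bdd by (auto simp: L_def intro!: bdd_belowI2)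
    obtain y where "y \<in> L x" "\<phi> y < Inf (\<phi> ` L x) + (1/2)^k"
      using cInf_lessD[OF ne, of "Inf (\<phi> ` L x) + (1/2)^k"] by auto
    moreover have "Inf (\<phi> ` L x) \<le> \<phi> z" if "z \<in> L x" for z
      using that by (intro cINF_lower[OF b])
    ultimately show ?thesis by force
  qed
  then obtain g where g: "\<And>x k. x \<in> S \<Longrightarrow> g x k \<in> L x"
    "\<And>x k z. x \<in> S \<Longrightarrow> z \<in> L x \<Longrightarrow> \<phi> (g x k) \<le> \<phi> z + (1/2)^k" by metis
  define u where "u = rec_nat x0 (\<lambda>k x. g x k)"
  have u0: "u 0 = x0" and uS: "u (Suc k) = g (u k) k" for k by (simp_all add: u_def)
  have uin: "u k \<in> S" for k
    by (induction k) (use x0 g(1) in \<open>auto simp: u0 uS L_def\<close>)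
  have step: "u (Suc k) \<in> L (u k)" for k unfolding uS by (rule g(1)[OF uin])
  have mono: "u j \<in> L (u k)" if "k \<le> j" for k j
    using that by (induction j rule: dec_induct) (auto intro: Lself uin Ltrans step)
  have dist: "\<eta> * d (u k) (u j) \<le> \<phi> (u k) - \<phi> (u j)" if "k \<le> j" for k j
    using mono[OF that] by (simp add: L_def)
  have dec: "decseq (\<lambda>k. \<phi> (u k))"
    unfolding decseq_def
  proof (intro allI impI)
    fix k j :: nat assume "k \<le> j"
    moreover have "0 \<le> \<eta> * d (u k) (u j)" using nonneg \<eta> by simp
    ultimately show "\<phi> (u j) \<le> \<phi> (u k)" using dist[of k j] by linarith
  qed
  obtain l where "(\<lambda>k. \<phi> (u k)) \<longlonglongrightarrow> l"
    using decseq_convergent[OF dec, of 0] bdd[OF uin] by blast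
  then have "Cauchy (\<lambda>k. \<phi> (u k))" by (rule LIMSEQ_imp_Cauchy)
  then have cau: "\<exists>K. \<forall>k\<ge>K. \<forall>j\<ge>k. d (u k) (u j) < e" if "e > 0" for e
  proof -
    assume "Cauchy (\<lambda>k. \<phi> (u k))"
    moreover have "\<eta> * e > 0" using that \<eta> by simp
    ultimately have "\<exists>K. \<forall>k\<ge>K. \<forall>j\<ge>K. norm (\<phi> (u k) - \<phi> (u j)) < \<eta> * e"
      by (rule CauchyD)
    then obtain K where K: "\<And>k j. k \<ge> K \<Longrightarrow> j \<ge> K \<Longrightarrow> \<bar>\<phi> (u k) - \<phi> (u j)\<bar> < \<eta> * e"
      by auto
    have "d (u k) (u j) < e" if "k \<ge> K" "j \<ge> k" for k j
    proof -
      have "\<eta> * d (u k) (u j) < \<eta> * e" using dist[OF that(2)] K[of k j] that by linarith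
      then show ?thesis using \<eta> by simp
    qed
    then show ?thesis by blast
  qed
  obtain x where x: "x \<in> S" "(\<lambda>k. d (u k) x) \<longlonglongrightarrow> 0" "\<And>k. \<phi> x \<le> \<phi> (u k)"
    using complete[OF uin dec cau] by blast
  have xL: "x \<in> L (u k)" for k
  proof -
    \<comment> \<open>The bound between \<open>u k\<close> and \<open>u j\<close> passes to the
      limit as \<open>j\<close> tends to infinity with \<open>k\<close> fixed.\<close>
    have "\<forall>\<^sub>F j in sequentially. \<phi> x + \<eta> * d (u k) x \<le> \<phi> (u k) + \<eta> * d (u j) x"
      unfolding eventually_sequentially
    proof (intro exI allI impI)
      fix j assume "k \<le> j"
      have "\<eta> * d (u k) x \<le> \<eta> * d (u k) (u j) + \<eta> * d (u j) x"
        using mult_left_mono[OF tri[of "u k" x "u j"], of \<eta>] \<eta> by (simp add: distrib_left)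
      then show "\<phi> x + \<eta> * d (u k) x \<le> \<phi> (u k) + \<eta> * d (u j) x"
        using dist[OF \<open>k \<le> j\<close>] x(3)[of j] by linarith
    qed
    moreover have "(\<lambda>j. \<phi> (u k) + \<eta> * d (u j) x) \<longlonglongrightarrow> \<phi> (u k) + \<eta> * 0"
      by (intro tendsto_intros x)
    ultimately have "\<phi> x + \<eta> * d (u k) x \<le> \<phi> (u k) + \<eta> * 0"
      by (intro tendsto_lowerbound) auto
    then show ?thesis using x(1) by (simp add: L_def)
  qed
  show ?thesis
  proof (rule that[OF x(1)])
    show "\<phi> x + \<eta> * d x0 x \<le> \<phi> x0" using xL[of 0] by (simp add: L_def u0)
    fix y assume y: "y \<in> S"
    show "\<phi> x - \<eta> * d x y \<le> \<phi> y"
    proof (rule ccontr)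
      assume "\<not> ?thesis"
      then have yL: "y \<in> L x" and less: "\<phi> y + \<eta> * d x y < \<phi> x" using y by (auto simp: L_def)
      \<comment> \<open>Such a \<open>y\<close> lies in every \<open>L (u k)\<close>, and the next
        iterate minimizes \<open>\<phi>\<close> there up to \<open>(1/2)^k\<close>.\<close>
      have "\<phi> x \<le> \<phi> y + (1/2)^k" for k
        using g(2)[OF uin Ltrans[OF xL yL], of k k] x(3)[of "Suc k"] unfolding uS by linarith
      moreover have "(\<lambda>k. \<phi> y + (1/2)^k) \<longlonglongrightarrow> \<phi> y + 0"
        by (intro tendsto_intros LIMSEQ_realpow_zero) auto
      ultimately have "\<phi> x \<le> \<phi> y + 0" by (intro LIMSEQ_le_const) auto
      moreover have "0 \<le> \<eta> * d x y" using nonneg \<eta> by simp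
      ultimately show False using less by linarith
    qed
  qed
qed

section \<open>An almost smooth bump on a subspace with separable dual\<close>

text \<open>Members of a dense subset of the dual of \<open>Y\<close> need not be restrictions of
  functionals of norm at most 1 on the whole space. A member is kept only if such a restriction lies
  within \<open>\<kappa>/2\<close> of it, and is then replaced by that functional; two errors of
  \<open>\<kappa>/2\<close> add up to \<open>\<kappa>\<close>.\<close>

lemma countable_dual_net:
  fixes Y :: "'a::real_normed_vector set"
  assumes Y: "subspace Y" and sep: "separable_space (Metric_space.mtopology (dual_on Y) (dual_dist Y))"
    and \<kappa>: "\<kappa> > 0"
  obtains G :: "nat \<Rightarrow> 'a \<Rightarrow>\<^sub>L real" where "\<And>m. norm (G m) \<le> 1"
    "\<And>F. norm F \<le> 1 \<Longrightarrow> \<exists>m. \<forall>v\<in>Y. \<bar>blinfun_apply F v - G m v\<bar> \<le> \<kappa> * norm v"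
proof -
  interpret M: Metric_space "dual_on Y" "dual_dist Y" by (rule Metric_space_dual[OF Y])
  obtain H where H: "countable H" "H \<subseteq> dual_on Y" "M.mtopology closure_of H = dual_on Y"
    using sep by (auto simp: separable_space_def)
  define close where "close F h \<longleftrightarrow> norm F \<le> 1 \<and> (\<forall>v\<in>Y. \<bar>blinfun_apply F v - h v\<bar> \<le> \<kappa>/2 * norm v)"
    for F :: "'a \<Rightarrow>\<^sub>L real" and h
  have near: "\<exists>h\<in>H. close F h" if F: "norm F \<le> 1" for F :: "'a \<Rightarrow>\<^sub>L real"
  proof -
    have FY: "restrict (blinfun_apply F) Y \<in> dual_on Y"
      using Y norm_blinfun[of F]
      by (auto simp: dual_on_def subspace_add subspace_scale blinfun.add_right blinfun.scaleR_right)
    then have "restrict (blinfun_apply F) Y \<in> M.mtopology closure_of H" by (simp only: H(3))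
    then have "\<forall>r>0. \<exists>h\<in>H. h \<in> M.mball (restrict (blinfun_apply F) Y) r"
      unfolding M.metric_closure_of by blast
    then obtain h where h: "h \<in> H" "dual_dist Y (restrict (blinfun_apply F) Y) h < \<kappa>/2"
      using \<kappa> unfolding M.in_mball by (meson half_gt_zero)
    then have hY: "h \<in> dual_on Y" using H(2) by auto
    have "\<bar>F v - h v\<bar> \<le> \<kappa>/2 * norm v" if v: "v \<in> Y" for v
    proof (cases "v = 0")
      case True
      have "h (0 *\<^sub>R v) = 0 * h v" using hY v unfolding dual_on_def by blast
      then show ?thesis using True by simp
    next
      case False
      define u where "u = (1 / norm v) *\<^sub>R v"
      have u: "u \<in> {x\<in>Y. norm x \<le> 1}" using v Y False by (auto simp: u_def subspace_scale)
      have "\<bar>restrict F Y u - h u\<bar> \<le> dual_dist Y (restrict (blinfun_apply F) Y) h"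
        using cSUP_upper[OF u dual_dist_bdd_above[OF FY hY]] FY hY by (simp add: dual_dist_def)
      then have "\<bar>F u - h u\<bar> \<le> \<kappa>/2" using h u by simp
      moreover have "h u = (1 / norm v) * h v" using hY v unfolding dual_on_def u_def by blast
      ultimately have "\<bar>(F v - h v) / norm v\<bar> \<le> \<kappa>/2"
        by (simp add: u_def blinfun.scaleR_right diff_divide_distrib)
      then show ?thesis using False by (simp add: field_simps)
    qed
    then show ?thesis using h F by (auto simp: close_def)
  qed
  \<comment> \<open>The functional 0 shows that \<open>H'\<close> is nonempty, so
    \<open>from_nat_into\<close> enumerates it, possibly with repetitions.\<close>
  define H' where "H' = {h\<in>H. \<exists>F. close F h}"
  have H': "countable H'" "H' \<noteq> {}" using H(1) near[of 0] by (auto simp: H'_def)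
  define G where "G m = (SOME F. close F (from_nat_into H' m))" for m
  have G: "close (G m) (from_nat_into H' m)" for m
  proof -
    have "from_nat_into H' m \<in> H'" by (rule from_nat_into[OF H'(2)])
    then have "\<exists>F. close F (from_nat_into H' m)" unfolding H'_def by blast
    then show ?thesis unfolding G_def by (rule someI_ex)
  qed
  show ?thesis
  proof (rule that)
    show "norm (G m) \<le> 1" for m using G[of m] by (simp add: close_def)
    fix F :: "'a \<Rightarrow>\<^sub>L real" assume F: "norm F \<le> 1"
    then obtain h where h: "h \<in> H" "close F h" using near by blast
    then obtain m where m: "from_nat_into H' m = h"
      using from_nat_into_surj[OF H'(1), of h] by (auto simp: H'_def)
    have "\<bar>F v - G m v\<bar> \<le> \<kappa> * norm v" if "v \<in> Y" for v
    proof -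
      have "\<bar>G m v - h v\<bar> \<le> \<kappa>/2 * norm v" "\<bar>F v - h v\<bar> \<le> \<kappa>/2 * norm v"
        using G[of m] h(2) that m by (auto simp: close_def)
      then show ?thesis by linarith
    qed
    then show "\<exists>m. \<forall>v\<in>Y. \<bar>F v - G m v\<bar> \<le> \<kappa> * norm v" by blast
  qed
qed

section \<open>The bump and its approximate derivatives\<close>

text \<open>The squared positive part has derivative \<open>2 * max 0 a\<close>, with a remainder of
  at most the square of the increment. It is the outer function of the bump below, where
  \<open>t\<close> bounds the increment of the inner function.\<close>

lemma max_square_le: "(max 0 (a + t))\<^sup>2 \<le> (max 0 a)\<^sup>2 + 2 * max 0 a * t + (t::real)\<^sup>2"
proof (cases "a \<ge> 0")
  case True
  have "(max 0 (a + t))\<^sup>2 \<le> (a + t)\<^sup>2" by (auto simp: max_def)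
  then show ?thesis using True by (simp add: power2_sum algebra_simps)
next
  case False
  then have "\<bar>max 0 (a + t)\<bar> \<le> \<bar>t\<bar>" by auto
  then show ?thesis using False by (simp add: max_def abs_le_square_iff split: if_splits)
qed

text \<open>Here \<open>q m\<close> is the support function of the cell of those functionals in the
  dual ball that are \<open>\<kappa>\<close>-close to \<open>G m\<close> on \<open>Y\<close>. All
  functionals of a cell agree with \<open>G m\<close> up to \<open>\<kappa>\<close>, so at every
  point \<open>G m\<close> bounds the increments of \<open>q m\<close> along \<open>Y\<close> from
  above up to that error. The cells cover the dual ball, and one of them contains a functional
  norming \<open>z\<close>.\<close>

lemma cover_seminorms:
  fixes Y :: "'a::real_normed_vector set" and G :: "nat \<Rightarrow> 'a \<Rightarrow>\<^sub>L real"
  assumes G: "\<And>m. norm (G m) \<le> 1"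
    and cover: "\<And>F. norm F \<le> 1 \<Longrightarrow> \<exists>m. \<forall>v\<in>Y. \<bar>blinfun_apply F v - G m v\<bar> \<le> \<kappa> * norm v"
    and \<kappa>: "\<kappa> > 0"
  obtains q :: "nat \<Rightarrow> 'a \<Rightarrow> real" where
    "\<And>m u v. \<bar>q m u - q m v\<bar> \<le> norm (u - v)" "\<And>m z. q m z \<le> norm z"
    "\<And>m z h. h \<in> Y \<Longrightarrow> q m (z + h) \<le> q m z + (G m h + \<kappa> * norm h)"
    "\<And>m z. z \<in> Y \<Longrightarrow> q m z \<le> G m z + \<kappa> * norm z"
    "\<And>z. \<exists>m. q m z = norm z"
proof -
  define A where "A m = {F :: 'a \<Rightarrow>\<^sub>L real. norm F \<le> 1 \<and> (\<forall>v\<in>Y. \<bar>blinfun_apply F v - G m v\<bar> \<le> \<kappa> * norm v)}" for m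
  define q where "q m z = (SUP F\<in>A m. blinfun_apply F z)" for m z
  have GA: "G m \<in> A m" for m using G \<kappa> by (auto simp: A_def)
  have Fle: "blinfun_apply F z \<le> norm z" if "F \<in> A m" for F m z
  proof -
    have "\<bar>F z\<bar> \<le> norm F * norm z" using norm_blinfun[of F z] by simp
    also have "\<dots> \<le> 1 * norm z" using that by (intro mult_right_mono) (auto simp: A_def)
    finally show ?thesis by simp
  qed
  have bdd: "bdd_above ((\<lambda>F. blinfun_apply F z) ` A m)" for z m
    using Fle by (auto intro!: bdd_aboveI2)
  have upper: "blinfun_apply F z \<le> q m z" if "F \<in> A m" for F m z
    unfolding q_def by (rule cSUP_upper[OF that bdd])
  have least: "q m z \<le> c" if "\<And>F. F \<in> A m \<Longrightarrow> blinfun_apply F z \<le> c" for m z c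
    unfolding q_def using GA that by (intro cSUP_least) auto
  have lip: "q m u - q m v \<le> norm (u - v)" for m u v
  proof -
    have "q m u \<le> q m v + norm (u - v)"
    proof (rule least)
      fix F assume "F \<in> A m"
      then show "F u \<le> q m v + norm (u - v)"
        using Fle[of F m "u - v"] upper[of F m v] by (simp add: blinfun.diff_right)
    qed
    then show ?thesis by simp
  qed
  show ?thesis
  proof (rule that)
    show "\<bar>q m u - q m v\<bar> \<le> norm (u - v)" for m u v
      using lip[of m u v] lip[of m v u] by (simp add: norm_minus_commute)
    show "q m z \<le> norm z" for m z by (rule least) (rule Fle)
    show "q m (z + h) \<le> q m z + (G m h + \<kappa> * norm h)" if "h \<in> Y" for m z h
    proof (rule least)
      fix F assume F: "F \<in> A m"
      then have "F h \<le> G m h + \<kappa> * norm h" using that by (force simp: A_def)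
      then show "F (z + h) \<le> q m z + (G m h + \<kappa> * norm h)"
        using upper[OF F, of z] by (simp add: blinfun.add_right)
    qed
    show "q m z \<le> G m z + \<kappa> * norm z" if "z \<in> Y" for m z
      using that by (intro least) (force simp: A_def)
    fix z :: 'a
    obtain F :: "'a \<Rightarrow>\<^sub>L real" where F: "norm F \<le> 1" "blinfun_apply F z = norm z"
      by (rule norming_functional)
    then obtain m where "F \<in> A m" using cover by (auto simp: A_def)
    then have "q m z = norm z" using upper[of F m z] F(2) by (intro antisym least Fle) auto
    then show "\<exists>m. q m z = norm z" ..
  qed
qed

text \<open>The bump is the limit of the partial sums \<open>\<Phi> N\<close>, through which it is
  handled because nothing bounds the full sum on the unit sphere and beyond; on smaller balls the
  partial sums stabilize. The lower bound \<open>\<Lambda> / 4\<close> does not involve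
  \<open>\<kappa>\<close>, so the approximate derivative \<open>f\<close> dominates the error
  \<open>\<kappa> * \<Lambda>\<close> when \<open>\<kappa>\<close> is small.\<close>

lemma almost_smooth_bump:
  fixes Y :: "'a::real_normed_vector set"
  assumes Y: "subspace Y" and sep: "separable_space (Metric_space.mtopology (dual_on Y) (dual_dist Y))"
    and \<kappa>: "\<kappa> > 0" "\<kappa> \<le> 1/4"
  obtains \<Phi> :: "nat \<Rightarrow> 'a \<Rightarrow> real" where
    "\<And>N. continuous_on UNIV (\<Phi> N)" "\<And>N z. \<Phi> N z \<ge> 0"
    "\<And>N z. norm z \<le> 1/2 \<Longrightarrow> \<Phi> N z = 0"
    "\<And>z. norm z \<ge> 1 \<Longrightarrow> \<exists>N. \<Phi> N z \<ge> 1"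
    "\<And>\<rho>. \<rho> < 1 \<Longrightarrow> \<exists>N. \<forall>M z. norm z \<le> \<rho> \<longrightarrow> \<Phi> M z \<le> \<Phi> N z"
    "\<And>N z. z \<in> Y \<Longrightarrow> norm z \<le> 1 \<Longrightarrow> \<exists>(f :: 'a \<Rightarrow>\<^sub>L real) \<Lambda> K. \<Lambda> \<ge> 0 \<and> K \<ge> 0 \<and> (\<Phi> N z > 0 \<longrightarrow> \<Lambda> > 0) \<and>
       norm f \<le> \<Lambda> \<and> blinfun_apply f z \<ge> \<Lambda> / 4 \<and>
       (\<forall>h\<in>Y. \<Phi> N (z + h) \<le> \<Phi> N z + blinfun_apply f h + \<kappa> * \<Lambda> * norm h + K * (norm h)\<^sup>2)"
proof -
  obtain G :: "nat \<Rightarrow> 'a \<Rightarrow>\<^sub>L real" where G: "\<And>m. norm (G m) \<le> 1"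
    "\<And>F. norm F \<le> 1 \<Longrightarrow> \<exists>m. \<forall>v\<in>Y. \<bar>blinfun_apply F v - G m v\<bar> \<le> \<kappa> * norm v"
    using countable_dual_net[OF Y sep \<kappa>(1)] by blast
  obtain q :: "nat \<Rightarrow> 'a \<Rightarrow> real" where q:
    "\<And>m u v. \<bar>q m u - q m v\<bar> \<le> norm (u - v)" "\<And>m z. q m z \<le> norm z"
    "\<And>m z h. h \<in> Y \<Longrightarrow> q m (z + h) \<le> q m z + (G m h + \<kappa> * norm h)"
    "\<And>m z. z \<in> Y \<Longrightarrow> q m z \<le> G m z + \<kappa> * norm z"
    "\<And>z. \<exists>m. q m z = norm z"
    using cover_seminorms[OF G \<kappa>(1)] by blast
  \<comment> \<open>Since \<open>w m\<close> decreases to 1, only finitely many terms are nonzero on a smaller ball; since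
    \<open>w m > 1\<close>, some term reaches 1 on the sphere, thanks to the weight \<open>C m = 1 / (w m - 1)\<^sup>2\<close>.\<close>
  define w :: "nat \<Rightarrow> real" where "w m = 1 + 1 / (real m + 1)" for m
  have w: "w m > 0" "w m \<le> 2" for m by (simp_all add: w_def add_pos_pos)
  define C :: "nat \<Rightarrow> real" where "C m = (real m + 1)\<^sup>2" for m
  have C: "C m > 0" for m unfolding C_def by (intro zero_less_power) linarith
  define \<psi> where "\<psi> m z = C m * (max 0 (w m * q m z - 1))\<^sup>2" for m z
  have \<psi>0: "\<psi> m z \<ge> 0" for m z using C[of m] by (simp add: \<psi>_def)
  have \<psi>z: "\<psi> m z = 0" if "w m * norm z \<le> 1" for m z
  proof -
    have "w m * q m z \<le> w m * norm z" using q(2) w(1)[of m] by (intro mult_left_mono) auto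
    then have "max 0 (w m * q m z - 1) = 0" using that by simp
    then show ?thesis by (simp add: \<psi>_def)
  qed
  define \<Phi> where "\<Phi> N z = (\<Sum>m<N. \<psi> m z)" for N z
  have qcont: "continuous_on UNIV (q m)" for m
  proof -
    have "1-lipschitz_on UNIV (q m)"
      using q(1)[of m] by (auto simp: lipschitz_on_def dist_norm)
    then show ?thesis by (rule lipschitz_on_continuous_on)
  qed
  show ?thesis
  proof (rule that)
    show "continuous_on UNIV (\<Phi> N)" for N
      unfolding \<Phi>_def \<psi>_def by (intro continuous_intros qcont)
    show "\<Phi> N z \<ge> 0" for N z unfolding \<Phi>_def by (intro sum_nonneg \<psi>0)
    show "\<Phi> N z = 0" if "norm z \<le> 1/2" for N z
    proof -
      have "w m * norm z \<le> 2 * (1/2)" for m using w[of m] that by (intro mult_mono) auto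
      then show ?thesis by (simp add: \<Phi>_def \<psi>z)
    qed
    show "\<exists>N. \<Phi> N z \<ge> 1" if z: "norm z \<ge> 1" for z
    proof -
      obtain m where m: "q m z = norm z" using q(5) by blast
      have "w m * 1 \<le> w m * norm z" using w(1)[of m] z by (intro mult_left_mono) auto
      then have "1 / (real m + 1) \<le> max 0 (w m * q m z - 1)" by (simp add: m w_def)
      then have "(1 / (real m + 1))\<^sup>2 \<le> (max 0 (w m * q m z - 1))\<^sup>2" by (intro power_mono) auto
      then have "C m * (1 / (real m + 1))\<^sup>2 \<le> \<psi> m z"
        unfolding \<psi>_def using C[of m] by (intro mult_left_mono) auto
      moreover have "C m * (1 / (real m + 1))\<^sup>2 = 1" by (simp add: C_def power_divide)
      ultimately have "1 \<le> \<psi> m z" by simp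
      also have "\<dots> \<le> \<Phi> (Suc m) z" using sum_nonneg[of "{..<m}" "\<lambda>m. \<psi> m z"] \<psi>0 by (simp add: \<Phi>_def)
      finally show ?thesis by blast
    qed
    show "\<exists>N. \<forall>M z. norm z \<le> \<rho> \<longrightarrow> \<Phi> M z \<le> \<Phi> N z" if \<rho>: "\<rho> < 1" for \<rho>
    proof -
      obtain N :: nat where N: "1 / (1 - \<rho>) < real N" using reals_Archimedean2 by blast
      have "\<Phi> M z \<le> \<Phi> N z" if z: "norm z \<le> \<rho>" for M z
      proof -
        have "\<psi> m z = 0" if "m \<ge> N" for m
        proof (rule \<psi>z)
          have "1 / (1 - \<rho>) \<le> real m + 1" using N that by simp
          then have "1 / (real m + 1) \<le> 1 - \<rho>" using \<rho> by (simp add: field_simps)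
          then have "w m * norm z \<le> (1 + (1 - \<rho>)) * \<rho>"
            unfolding w_def using z \<rho> by (intro mult_mono) auto
          \<comment> \<open>The left side equals \<open>1 - (1 - \<rho>)\<^sup>2\<close>.\<close>
          also have "\<dots> \<le> 1"
            using zero_le_power2[of "1 - \<rho>"] by (simp add: power2_eq_square algebra_simps)
          finally show "w m * norm z \<le> 1" .
        qed
        then have "\<psi> m z = 0" if "m \<in> {..<M} - {..<M} \<inter> {..<N}" for m
          using that by (metis DiffE IntI lessThan_iff not_less)
        then have "\<Phi> M z = (\<Sum>m\<in>{..<M} \<inter> {..<N}. \<psi> m z)"
          unfolding \<Phi>_def by (intro sum.mono_neutral_right) auto
        also have "\<dots> \<le> \<Phi> N z" unfolding \<Phi>_def using \<psi>0 by (intro sum_mono2) auto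
        finally show ?thesis .
      qed
      then show ?thesis by blast
    qed
    fix N z assume zY: "z \<in> Y" and z: "norm z \<le> 1"
    \<comment> \<open>By the chain rule, \<open>l m\<close> is the weight of \<open>G m\<close> in
      the approximate derivative of \<open>\<psi> m\<close> at \<open>z\<close>.\<close>
    define l where "l m = 2 * C m * max 0 (w m * q m z - 1) * w m" for m
    have l0: "l m \<ge> 0" for m using C[of m] w[of m] by (simp add: l_def)
    define \<Lambda> where "\<Lambda> = (\<Sum>m<N. l m)"
    define K where "K = (\<Sum>m<N. C m * (w m * (1 + \<kappa>))\<^sup>2)"
    define f :: "'a \<Rightarrow>\<^sub>L real" where "f = (\<Sum>m<N. l m *\<^sub>R G m)"
    have f: "f h = (\<Sum>m<N. l m * G m h)" for h
      by (simp add: f_def blinfun.sum_left blinfun.scaleR_left)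
    show "\<exists>(f :: 'a \<Rightarrow>\<^sub>L real) \<Lambda> K. \<Lambda> \<ge> 0 \<and> K \<ge> 0 \<and> (\<Phi> N z > 0 \<longrightarrow> \<Lambda> > 0) \<and>
       norm f \<le> \<Lambda> \<and> blinfun_apply f z \<ge> \<Lambda> / 4 \<and>
       (\<forall>h\<in>Y. \<Phi> N (z + h) \<le> \<Phi> N z + blinfun_apply f h + \<kappa> * \<Lambda> * norm h + K * (norm h)\<^sup>2)"
    proof (intro exI conjI impI ballI)
      show "\<Lambda> \<ge> 0" unfolding \<Lambda>_def by (intro sum_nonneg l0)
      show "K \<ge> 0" unfolding K_def using C by (intro sum_nonneg mult_nonneg_nonneg) (auto simp: less_imp_le)
      show "\<Lambda> > 0" if "\<Phi> N z > 0"
      proof -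
        have "\<exists>m<N. \<psi> m z > 0"
        proof (rule ccontr)
          assume "\<not> ?thesis"
          then have "\<psi> m z \<le> 0" if "m < N" for m using that by (meson not_less)
          then have "\<Phi> N z \<le> 0" unfolding \<Phi>_def by (intro sum_nonpos) simp
          then show False using that by simp
        qed
        then obtain m where m: "m < N" "\<psi> m z > 0" by blast
        then have "max 0 (w m * q m z - 1) \<noteq> 0" by (intro notI) (simp add: \<psi>_def)
        then have "max 0 (w m * q m z - 1) > 0" by linarith
        then have "l m > 0" using C[of m] w(1)[of m] unfolding l_def by (intro mult_pos_pos) auto
        then show ?thesis unfolding \<Lambda>_def using m(1) l0 by (intro sum_pos2[of _ m]) auto
      qed
      show "norm f \<le> \<Lambda>"
        unfolding f_def \<Lambda>_def
      proof (intro sum_norm_le)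
        fix m show "norm (l m *\<^sub>R G m) \<le> l m"
          using mult_left_mono[OF G(1)[of m] l0[of m]] l0[of m] by simp
      qed
      \<comment> \<open>Only terms with \<open>w m * q m z > 1\<close> have nonzero weight. For
        these \<open>q m z > 1/2\<close>, because \<open>w m \<le> 2\<close>, and replacing
        \<open>q m\<close> by \<open>G m\<close> costs at most
        \<open>\<kappa> \<le> 1/4\<close>.\<close>
      have "l m * (1/4) \<le> l m * G m z" for m
      proof (cases "w m * q m z > 1")
        case True
        have "q m z > 1/2"
        proof (rule ccontr)
          assume "\<not> ?thesis"
          then have "w m * q m z \<le> w m * (1/2)" using w(1)[of m] by (intro mult_left_mono) auto
          then show False using True w(2)[of m] by simp
        qed
        moreover have "\<kappa> * norm z \<le> 1/4 * 1" using \<kappa> z by (intro mult_mono) auto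
        ultimately have "1/4 \<le> G m z" using q(4)[OF zY, of m] by simp
        then show ?thesis using l0 by (rule mult_left_mono)
      next
        case False
        then show ?thesis by (simp add: l_def)
      qed
      then show "f z \<ge> \<Lambda> / 4"
        unfolding f \<Lambda>_def by (simp add: sum_divide_distrib sum_mono)
      fix h assume h: "h \<in> Y"
      have "\<psi> m (z + h) \<le> \<psi> m z + l m * G m h + \<kappa> * l m * norm h + C m * (w m * (1 + \<kappa>))\<^sup>2 * (norm h)\<^sup>2" for m
      proof -
        \<comment> \<open>An upper bound for the increment of \<open>w m * q m\<close> from
          \<open>z\<close> to \<open>z + h\<close>, to be inserted into
          \<open>max_square_le\<close>.\<close>
        define t where "t = w m * (G m h + \<kappa> * norm h)"
        have "\<bar>G m h\<bar> \<le> norm (G m) * norm h" using norm_blinfun[of "G m" h] by simp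
        also have "\<dots> \<le> 1 * norm h" by (intro mult_right_mono G) auto
        finally have "\<bar>G m h\<bar> \<le> 1 * norm h" .
        moreover have "\<bar>\<kappa> * norm h\<bar> = \<kappa> * norm h" using \<kappa>(1) by simp
        ultimately have "\<bar>G m h + \<kappa> * norm h\<bar> \<le> (1 + \<kappa>) * norm h" by (simp add: distrib_right)
        then have "\<bar>t\<bar> \<le> w m * ((1 + \<kappa>) * norm h)"
          unfolding t_def abs_mult using w(1)[of m] by (intro mult_mono) auto
        then have t2: "t\<^sup>2 \<le> (w m * ((1 + \<kappa>) * norm h))\<^sup>2"
          by (metis abs_ge_zero power2_abs power_mono)
        have "w m * q m (z + h) \<le> w m * (q m z + (G m h + \<kappa> * norm h))"
          using q(3)[OF h, of m z] w(1)[of m] by (intro mult_left_mono) auto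
        then have "max 0 (w m * q m (z + h) - 1) \<le> max 0 (w m * q m z - 1 + t)"
          by (simp add: t_def distrib_left)
        then have "(max 0 (w m * q m (z + h) - 1))\<^sup>2 \<le> (max 0 (w m * q m z - 1 + t))\<^sup>2"
          by (intro power_mono) auto
        also have "\<dots> \<le> (max 0 (w m * q m z - 1))\<^sup>2 + 2 * max 0 (w m * q m z - 1) * t + (w m * ((1 + \<kappa>) * norm h))\<^sup>2"
          using max_square_le[of "w m * q m z - 1" t] t2 by linarith
        finally have "\<psi> m (z + h) \<le> C m * ((max 0 (w m * q m z - 1))\<^sup>2 + 2 * max 0 (w m * q m z - 1) * t + (w m * ((1 + \<kappa>) * norm h))\<^sup>2)"
          unfolding \<psi>_def using C[of m] by (intro mult_left_mono) auto
        moreover have "(w m * ((1 + \<kappa>) * norm h))\<^sup>2 = (w m * (1 + \<kappa>))\<^sup>2 * (norm h)\<^sup>2"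
          by (simp only: power_mult_distrib mult.assoc)
        ultimately show ?thesis by (simp add: \<psi>_def l_def t_def algebra_simps)
      qed
      then have "\<Phi> N (z + h) \<le> (\<Sum>m<N. \<psi> m z + l m * G m h + \<kappa> * l m * norm h + C m * (w m * (1 + \<kappa>))\<^sup>2 * (norm h)\<^sup>2)"
        unfolding \<Phi>_def by (intro sum_mono)
      also have "\<dots> = \<Phi> N z + f h + \<kappa> * \<Lambda> * norm h + K * (norm h)\<^sup>2"
        by (simp add: \<Phi>_def f \<Lambda>_def K_def sum.distrib sum_distrib_left sum_distrib_right)
      finally show "\<Phi> N (z + h) \<le> \<Phi> N z + f h + \<kappa> * \<Lambda> * norm h + K * (norm h)\<^sup>2" .
    qed
  qed
qed

section \<open>Separable reduction\<close>

definition normal_gap ::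
  "'i set \<Rightarrow> real \<Rightarrow> ('i \<Rightarrow> 'a::real_normed_vector) \<Rightarrow> ('i \<Rightarrow> 'a) \<Rightarrow> 'a \<Rightarrow> ('i \<Rightarrow> 'a set) \<Rightarrow> ('i \<Rightarrow> 'a \<Rightarrow> real) \<Rightarrow> real"
  where "normal_gap I \<epsilon> x e v T l =
    (\<Sum>i\<in>I. norm (e i - v - (\<Sum>\<omega>\<in>T i. l i \<omega> *\<^sub>R (\<omega> - x i))) + \<epsilon> * (\<Sum>\<omega>\<in>T i. l i \<omega> * norm (\<omega> - x i)))"

text \<open>
  A lower bound on the gap certifies, by duality, functionals summing to 0 that are
  \<open>\<epsilon>\<close>-normal to the sets \<open>T i\<close> at \<open>x i\<close> and that are bounded below on \<open>e\<close>: the vector \<open>v\<close> is the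
  multiplier of the constraint on the sum, the coefficients \<open>l\<close> are those of the normality constraints.
\<close>

definition feasible ::
  "'i set \<Rightarrow> ('i \<Rightarrow> 'a::real_normed_vector) \<Rightarrow> real \<Rightarrow> ('i \<Rightarrow> 'a set) \<Rightarrow> ('i \<Rightarrow> 'a \<Rightarrow> real) \<Rightarrow> bool"
  where "feasible I x \<delta> T l \<longleftrightarrow>
    (\<forall>i\<in>I. finite (T i) \<and> (\<forall>\<omega>\<in>T i. norm (\<omega> - x i) < \<delta> \<and> l i \<omega> \<ge> 0))"

lemma normal_gap_nonneg:
  assumes "feasible I x \<delta> T l" "\<epsilon> \<ge> 0"
  shows "normal_gap I \<epsilon> x e v T l \<ge> 0"
  unfolding normal_gap_def using assms
  by (auto simp: feasible_def intro!: sum_nonneg add_nonneg_nonneg mult_nonneg_nonneg)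

text \<open>Stated for values in any real vector space so that it serves both the vectors
  \<open>\<omega> - x i\<close> and their norms.\<close>

lemma sum_union_coefficients:
  fixes g :: "'b \<Rightarrow> 'c::real_vector"
  assumes "finite A" "finite B"
  shows "(\<Sum>\<omega>\<in>A \<union> B. ((if \<omega> \<in> A then k \<omega> else 0) + (if \<omega> \<in> B then l \<omega> else 0)) *\<^sub>R g \<omega>)
    = (\<Sum>\<omega>\<in>A. k \<omega> *\<^sub>R g \<omega>) + (\<Sum>\<omega>\<in>B. l \<omega> *\<^sub>R g \<omega>)"
proof -
  have "(\<Sum>\<omega>\<in>A \<union> B. (if \<omega> \<in> A then k \<omega> else 0) *\<^sub>R g \<omega>) = (\<Sum>\<omega>\<in>A. k \<omega> *\<^sub>R g \<omega>)"
    using assms by (intro sum.mono_neutral_cong_right) auto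
  moreover have "(\<Sum>\<omega>\<in>A \<union> B. (if \<omega> \<in> B then l \<omega> else 0) *\<^sub>R g \<omega>) = (\<Sum>\<omega>\<in>B. l \<omega> *\<^sub>R g \<omega>)"
    using assms by (intro sum.mono_neutral_cong_right) auto
  ultimately show ?thesis by (simp add: scaleR_left_distrib sum.distrib)
qed

text \<open>Coefficients add up on the union of the finite sets, each family being cut off to 0
  outside its own set. Together with the scaling rule this makes the infimum of the gap over
  \<open>v\<close>, \<open>T\<close> and \<open>l\<close> a sublinear function of
  \<open>e\<close>.\<close>

lemma normal_gap_add:
  assumes "feasible I x \<delta> T l" "feasible I x \<delta> T' l'"
  defines "T'' \<equiv> \<lambda>i. T i \<union> T' i"
    and "l'' \<equiv> \<lambda>i \<omega>. (if \<omega> \<in> T i then l i \<omega> else 0) + (if \<omega> \<in> T' i then l' i \<omega> else 0)"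
  shows "feasible I x \<delta> T'' l''"
    and "normal_gap I \<epsilon> x (\<lambda>i. e i + e' i) (v + v') T'' l'' \<le> normal_gap I \<epsilon> x e v T l + normal_gap I \<epsilon> x e' v' T' l'"
proof -
  show "feasible I x \<delta> T'' l''" using assms(1,2) by (auto simp: feasible_def T''_def l''_def)
  show "normal_gap I \<epsilon> x (\<lambda>i. e i + e' i) (v + v') T'' l'' \<le> normal_gap I \<epsilon> x e v T l + normal_gap I \<epsilon> x e' v' T' l'"
    unfolding normal_gap_def sum.distrib[symmetric]
  proof (rule sum_mono)
    fix i assume "i \<in> I"
    then have fin: "finite (T i)" "finite (T' i)" using assms(1,2) by (auto simp: feasible_def)
    have 1: "(\<Sum>\<omega>\<in>T'' i. l'' i \<omega> *\<^sub>R (\<omega> - x i)) = (\<Sum>\<omega>\<in>T i. l i \<omega> *\<^sub>R (\<omega> - x i)) + (\<Sum>\<omega>\<in>T' i. l' i \<omega> *\<^sub>R (\<omega> - x i))"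
      unfolding T''_def l''_def by (rule sum_union_coefficients[OF fin])
    have 2: "(\<Sum>\<omega>\<in>T'' i. l'' i \<omega> * norm (\<omega> - x i)) = (\<Sum>\<omega>\<in>T i. l i \<omega> * norm (\<omega> - x i)) + (\<Sum>\<omega>\<in>T' i. l' i \<omega> * norm (\<omega> - x i))"
      using sum_union_coefficients[OF fin, of "l i" "l' i" "\<lambda>\<omega>. norm (\<omega> - x i)"]
      unfolding T''_def l''_def real_scaleR_def .
    have "e i + e' i - (v + v') - (\<Sum>\<omega>\<in>T'' i. l'' i \<omega> *\<^sub>R (\<omega> - x i))
      = (e i - v - (\<Sum>\<omega>\<in>T i. l i \<omega> *\<^sub>R (\<omega> - x i))) + (e' i - v' - (\<Sum>\<omega>\<in>T' i. l' i \<omega> *\<^sub>R (\<omega> - x i)))"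
      unfolding 1 by (simp add: algebra_simps)
    then have "norm (e i + e' i - (v + v') - (\<Sum>\<omega>\<in>T'' i. l'' i \<omega> *\<^sub>R (\<omega> - x i)))
      \<le> norm (e i - v - (\<Sum>\<omega>\<in>T i. l i \<omega> *\<^sub>R (\<omega> - x i))) + norm (e' i - v' - (\<Sum>\<omega>\<in>T' i. l' i \<omega> *\<^sub>R (\<omega> - x i)))"
      by (simp only: norm_triangle_ineq)
    then show "norm (e i + e' i - (v + v') - (\<Sum>\<omega>\<in>T'' i. l'' i \<omega> *\<^sub>R (\<omega> - x i))) + \<epsilon> * (\<Sum>\<omega>\<in>T'' i. l'' i \<omega> * norm (\<omega> - x i))
      \<le> norm (e i - v - (\<Sum>\<omega>\<in>T i. l i \<omega> *\<^sub>R (\<omega> - x i))) + \<epsilon> * (\<Sum>\<omega>\<in>T i. l i \<omega> * norm (\<omega> - x i))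
       + (norm (e' i - v' - (\<Sum>\<omega>\<in>T' i. l' i \<omega> *\<^sub>R (\<omega> - x i))) + \<epsilon> * (\<Sum>\<omega>\<in>T' i. l' i \<omega> * norm (\<omega> - x i)))"
      unfolding 2 distrib_left by linarith
  qed
qed

lemma normal_gap_scale:
  assumes "c \<ge> 0"
  shows "normal_gap I \<epsilon> x (\<lambda>i. c *\<^sub>R e i) (c *\<^sub>R v) T (\<lambda>i \<omega>. c * l i \<omega>) = c * normal_gap I \<epsilon> x e v T l"
proof -
  have "norm (c *\<^sub>R e i - c *\<^sub>R v - (\<Sum>\<omega>\<in>T i. (c * l i \<omega>) *\<^sub>R (\<omega> - x i)))
     = c * norm (e i - v - (\<Sum>\<omega>\<in>T i. l i \<omega> *\<^sub>R (\<omega> - x i)))" for i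
  proof -
    have "c *\<^sub>R e i - c *\<^sub>R v - (\<Sum>\<omega>\<in>T i. (c * l i \<omega>) *\<^sub>R (\<omega> - x i)) = c *\<^sub>R (e i - v - (\<Sum>\<omega>\<in>T i. l i \<omega> *\<^sub>R (\<omega> - x i)))"
      by (simp add: scaleR_right_diff_distrib scaleR_sum_right)
    then show ?thesis using assms by simp
  qed
  then show ?thesis
    by (simp add: normal_gap_def sum_distrib_left distrib_left mult.assoc mult.left_commute)
qed

text \<open>The infimum \<open>p\<close> of the gap is sublinear on families, so the Hahn-Banach
  theorem gives a linear \<open>F \<le> p\<close> with \<open>F e = p e \<ge> c\<close>, and the
  components of \<open>F\<close> are the functionals. Each required property comes from inserting a
  particular \<open>v\<close>, \<open>T\<close>, \<open>l\<close> into
  \<open>F \<le> p\<close>.\<close>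

lemma normal_multipliers:
  fixes x :: "'i \<Rightarrow> 'a::real_normed_vector"
  assumes I: "finite I" and \<epsilon>: "\<epsilon> \<ge> 0"
    and gap: "\<And>v T l. feasible I x \<delta> T l \<Longrightarrow> \<forall>i\<in>I. T i \<subseteq> \<Omega> i \<Longrightarrow> normal_gap I \<epsilon> x e v T l \<ge> c"
  obtains xs :: "'i \<Rightarrow> 'a \<Rightarrow>\<^sub>L real" where "(\<Sum>i\<in>I. xs i) = 0" "(\<Sum>i\<in>I. blinfun_apply (xs i) (e i)) \<ge> c"
    "\<And>i \<omega>. i \<in> I \<Longrightarrow> \<omega> \<in> \<Omega> i \<Longrightarrow> norm (\<omega> - x i) < \<delta> \<Longrightarrow> blinfun_apply (xs i) (\<omega> - x i) \<le> \<epsilon> * norm (\<omega> - x i)"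
proof -
  define scl where "scl c w = (\<lambda>i. c *\<^sub>R w i)" for c and w :: "'i \<Rightarrow> 'a"
  have vs: "vector_space scl"
    by unfold_locales (auto simp: scl_def fun_eq_iff algebra_simps)
  define Q where "Q w = {normal_gap I \<epsilon> x w v T l | v T l. feasible I x \<delta> T l \<and> (\<forall>i\<in>I. T i \<subseteq> \<Omega> i)}" for w
  define p where "p w = Inf (Q w)" for w
  have ne: "Q w \<noteq> {}" for w
  proof -
    have "feasible I x \<delta> (\<lambda>_. {}) (\<lambda>_ _. 0)" by (simp add: feasible_def)
    then show ?thesis by (auto simp: Q_def)
  qed
  have bdd: "bdd_below (Q w)" for w
    using normal_gap_nonneg[OF _ \<epsilon>] by (auto simp: Q_def intro!: bdd_belowI[of _ 0])
  have p_le: "p w \<le> normal_gap I \<epsilon> x w v T l" if "feasible I x \<delta> T l" "\<forall>i\<in>I. T i \<subseteq> \<Omega> i" for w v T l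
    unfolding p_def using that by (intro cInf_lower[OF _ bdd]) (auto simp: Q_def)
  have p_ge: "b \<le> p w"
    if "\<And>v T l. feasible I x \<delta> T l \<Longrightarrow> \<forall>i\<in>I. T i \<subseteq> \<Omega> i \<Longrightarrow> b \<le> normal_gap I \<epsilon> x w v T l" for b w
    unfolding p_def using that ne by (intro cInf_greatest) (auto simp: Q_def)
  have "sublinear scl p"
    unfolding sublinear_def
  proof (intro conjI allI impI)
    fix w w'
    have *: "p (w + w') \<le> normal_gap I \<epsilon> x w v T l + normal_gap I \<epsilon> x w' v' T' l'"
      if "feasible I x \<delta> T l" "\<forall>i\<in>I. T i \<subseteq> \<Omega> i" "feasible I x \<delta> T' l'" "\<forall>i\<in>I. T' i \<subseteq> \<Omega> i" for v T l v' T' l'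
    proof -
      note n = normal_gap_add[OF that(1,3)]
      have "p (w + w') \<le> normal_gap I \<epsilon> x (\<lambda>i. w i + w' i) (v + v') (\<lambda>i. T i \<union> T' i)
         (\<lambda>i \<omega>. (if \<omega> \<in> T i then l i \<omega> else 0) + (if \<omega> \<in> T' i then l' i \<omega> else 0))"
        unfolding func_plus using that by (intro p_le n(1)) auto
      then show ?thesis using n(2) by (rule order_trans)
    qed
    have "p (w + w') - normal_gap I \<epsilon> x w' v' T' l' \<le> p w"
      if "feasible I x \<delta> T' l'" "\<forall>i\<in>I. T' i \<subseteq> \<Omega> i" for v' T' l'
      using *[OF _ _ that] by (intro p_ge) (simp add: algebra_simps)
    then have "p (w + w') - p w \<le> p w'"
      by (intro p_ge) (simp add: algebra_simps)
    then show "p (w + w') \<le> p w + p w'" by simp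
  next
    fix c :: real and w assume c: "c > 0"
    have "p (scl c w) / c \<le> p w"
    proof (rule p_ge)
      fix v T l assume f: "feasible I x \<delta> T l" "\<forall>i\<in>I. T i \<subseteq> \<Omega> i"
      then have "feasible I x \<delta> T (\<lambda>i \<omega>. c * l i \<omega>)" using c by (auto simp: feasible_def)
      from p_le[OF this f(2), of "scl c w" "c *\<^sub>R v"]
      have "p (scl c w) \<le> c * normal_gap I \<epsilon> x w v T l"
        using normal_gap_scale[of c I \<epsilon> x w v T l] c by (simp add: scl_def)
      then show "p (scl c w) / c \<le> normal_gap I \<epsilon> x w v T l" using c by (simp add: field_simps)
    qed
    then show "p (scl c w) \<le> c * p w" using c by (simp add: field_simps)
  qed
  from hahn_banach[OF vs this, of e] obtain F where F: "\<And>x y. F (x + y) = F x + F y" "\<And>c x. F (scl c x) = c * F x"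
    "\<And>x. F x \<le> p x" "F e = p e" by blast
  have F0: "F (\<lambda>i. 0) = 0"
    using F(2)[of 0 "\<lambda>i. 0"] by (simp add: scl_def)
  have Fadd: "F (\<lambda>i. a i + b i) = F a + F b" for a b using F(1)[of a b] by (simp add: func_plus)
  have Fscl: "F (\<lambda>i. c *\<^sub>R a i) = c * F a" for c a using F(2)[of c a] by (simp add: scl_def)
  define u where "u i v = (\<lambda>j. if j = i then v else 0)" for i :: 'i and v :: 'a
  \<comment> \<open>Empty sets \<open>T\<close> leave only \<open>v\<close>. Taking
    \<open>v = 0\<close> bounds the components; a family that is constantly \<open>v\<close> on
    \<open>I\<close> has \<open>F w \<le> 0\<close>, which makes the components sum to 0.\<close>
  have Fnorm: "F w \<le> (\<Sum>i\<in>I. norm (w i - v))" for w v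
  proof -
    have "p w \<le> normal_gap I \<epsilon> x w v (\<lambda>_. {}) (\<lambda>_ _. 0)"
      by (intro p_le) (auto simp: feasible_def)
    then show ?thesis using F(3)[of w] by (simp add: normal_gap_def)
  qed
  have Fu_le: "F (u i v) \<le> norm v" if "i \<in> I" for i v
  proof -
    have "(\<Sum>j\<in>I. norm (u i v j - 0)) = (\<Sum>j\<in>I. if j = i then norm v else 0)"
      by (intro sum.cong) (auto simp: u_def)
    then show ?thesis using Fnorm[of "u i v" 0] I that by simp
  qed
  have lin: "bounded_linear (\<lambda>v. F (u i v))" if "i \<in> I" for i
  proof (rule bounded_linear_intro[of _ 1])
    show "F (u i (a + b)) = F (u i a) + F (u i b)" for a b
      unfolding Fadd[symmetric] by (rule arg_cong[of _ _ F]) (auto simp: u_def)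
    show *: "F (u i (c *\<^sub>R a)) = c *\<^sub>R F (u i a)" for c a
      unfolding real_scaleR_def Fscl[symmetric] by (rule arg_cong[of _ _ F]) (auto simp: u_def)
    show "norm (F (u i a)) \<le> norm a * 1" for a
      using Fu_le[OF that, of a] Fu_le[OF that, of "- a"] *[of "-1" a] by simp
  qed
  define xs where "xs i = Blinfun (\<lambda>v. F (u i v))" for i
  have xs: "blinfun_apply (xs i) v = F (u i v)" if "i \<in> I" for i v
    unfolding xs_def using bounded_linear_Blinfun_apply[OF lin[OF that]] by simp
  have Fzero: "F w \<le> 0" if "\<And>i. i \<in> I \<Longrightarrow> w i = v" for w v
    using Fnorm[of w v] that by simp
  have decomp: "(\<Sum>i\<in>J. F (u i (w i))) = F (\<lambda>j. if j \<in> J then w j else 0)" if "finite J" for J w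
    using that
  proof (induction J rule: finite_induct)
    case empty
    then show ?case by (simp add: F0)
  next
    case (insert i J)
    then have "(\<Sum>i\<in>insert i J. F (u i (w i))) = F (\<lambda>j. u i (w i) j + (if j \<in> J then w j else 0))"
      by (simp add: Fadd)
    also have "(\<lambda>j. u i (w i) j + (if j \<in> J then w j else 0)) = (\<lambda>j. if j \<in> insert i J then w j else 0)"
      using insert by (auto simp: u_def fun_eq_iff)
    finally show ?case .
  qed
  show ?thesis
  proof (rule that)
    show "(\<Sum>i\<in>I. xs i) = 0"
    proof (rule blinfun_eqI)
      fix v :: 'a
      have s: "blinfun_apply (\<Sum>i\<in>I. xs i) v = F (\<lambda>j. if j \<in> I then v else 0)" for v
        using decomp[OF I, of "\<lambda>_. v"] by (simp add: blinfun.sum_left xs)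
      have "blinfun_apply (\<Sum>i\<in>I. xs i) v \<le> 0" for v
        unfolding s by (rule Fzero[of _ v]) simp
      from this[of v] this[of "- v"] show "blinfun_apply (\<Sum>i\<in>I. xs i) v = blinfun_apply 0 v"
        by (simp add: blinfun.minus_right)
    qed
    have "(\<Sum>i\<in>I. blinfun_apply (xs i) (e i)) = F (\<lambda>j. if j \<in> I then e j else 0)"
      using decomp[OF I, of e] by (simp add: xs)
    \<comment> \<open>The part of \<open>e\<close> outside \<open>I\<close> contributes at most 0,
      so discarding it does not lower the value.\<close>
    moreover have "F e = F (\<lambda>j. if j \<in> I then e j else 0) + F (\<lambda>j. if j \<in> I then 0 else e j)"
      unfolding Fadd[symmetric] by (rule arg_cong[of _ _ F]) auto
    moreover have "F (\<lambda>j. if j \<in> I then 0 else e j) \<le> 0" by (rule Fzero[of _ 0]) simp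
    moreover have "c \<le> p e" by (rule p_ge) (rule gap)
    ultimately show "(\<Sum>i\<in>I. blinfun_apply (xs i) (e i)) \<ge> c" using F(4) by linarith
    fix i \<omega> assume i: "i \<in> I" "\<omega> \<in> \<Omega> i" "norm (\<omega> - x i) < \<delta>"
    \<comment> \<open>The single point \<open>\<omega>\<close> with coefficient 1 cancels the vector
      inside the norm, and only the penalty \<open>\<epsilon> * norm (\<omega> - x i)\<close>
      remains.\<close>
    define T where "T = (\<lambda>j. if j = i then {\<omega>} else {})"
    have "p (u i (\<omega> - x i)) \<le> normal_gap I \<epsilon> x (u i (\<omega> - x i)) 0 T (\<lambda>_ _. 1)"
      using i by (intro p_le) (auto simp: feasible_def T_def)
    also have "\<dots> = (\<Sum>j\<in>I. if j = i then \<epsilon> * norm (\<omega> - x i) else 0)"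
      unfolding normal_gap_def by (intro sum.cong refl) (auto simp: T_def u_def)
    also have "\<dots> = \<epsilon> * norm (\<omega> - x i)" using I i by simp
    finally show "blinfun_apply (xs i) (\<omega> - x i) \<le> \<epsilon> * norm (\<omega> - x i)"
      using F(3)[of "u i (\<omega> - x i)"] i by (simp add: xs)
  qed
qed

text \<open>Moving a base point by \<open>\<theta>\<close> changes each weighted sum by at most
  \<open>\<theta>\<close> times the total of the coefficients. The bound \<open>M\<close> on these
  totals makes the change uniform in \<open>T\<close>, \<open>l\<close> and
  \<open>v\<close>.\<close>

lemma normal_gap_perturb:
  fixes \<delta> \<epsilon> M \<theta> :: real
  assumes f: "feasible I x \<delta> T l" and \<epsilon>: "\<epsilon> \<ge> 0"
    and M: "\<And>i. i \<in> I \<Longrightarrow> sum (l i) (T i) \<le> M"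
    and near: "\<And>i. i \<in> I \<Longrightarrow> norm (x i - x' i) \<le> \<theta>" "\<And>i. i \<in> I \<Longrightarrow> norm (e i - e' i) \<le> \<theta>"
  shows "feasible I x' (\<delta> + \<theta>) T l"
    and "normal_gap I \<epsilon> x' e' v T l \<le> normal_gap I \<epsilon> x e v T l + card I * (1 + M * (1 + \<epsilon>)) * \<theta>"
proof -
  have move: "norm (\<omega> - x' i) \<le> norm (\<omega> - x i) + \<theta>" if "i \<in> I" for i \<omega>
    using norm_triangle_ineq[of "\<omega> - x i" "x i - x' i"] near(1)[OF that] by simp
  show "feasible I x' (\<delta> + \<theta>) T l"
    unfolding feasible_def
  proof (intro ballI conjI)
    fix i \<omega> assume "i \<in> I" "\<omega> \<in> T i"
    then have "norm (\<omega> - x i) < \<delta>" using f by (simp add: feasible_def)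
    then show "norm (\<omega> - x' i) < \<delta> + \<theta>" using move[OF \<open>i \<in> I\<close>, of \<omega>] by linarith
  qed (use f in \<open>auto simp: feasible_def\<close>)
  have "normal_gap I \<epsilon> x' e' v T l \<le> (\<Sum>i\<in>I. norm (e i - v - (\<Sum>\<omega>\<in>T i. l i \<omega> *\<^sub>R (\<omega> - x i))) + \<epsilon> * (\<Sum>\<omega>\<in>T i. l i \<omega> * norm (\<omega> - x i)) + (1 + M * (1 + \<epsilon>)) * \<theta>)"
    unfolding normal_gap_def
  proof (rule sum_mono)
    fix i assume i: "i \<in> I"
    have l: "l i \<omega> \<ge> 0" if "\<omega> \<in> T i" for \<omega> using f i that by (auto simp: feasible_def)
    have \<theta>: "\<theta> \<ge> 0" using near(1)[OF i] norm_ge_zero order_trans by blast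
    define L where "L = sum (l i) (T i)"
    have L: "0 \<le> L" "L \<le> M" using l M[OF i] by (auto simp: L_def intro: sum_nonneg)
    have L\<theta>: "L * \<theta> \<le> M * \<theta>" using L \<theta> by (intro mult_right_mono)
    have "(\<Sum>\<omega>\<in>T i. l i \<omega> *\<^sub>R (\<omega> - x' i)) = (\<Sum>\<omega>\<in>T i. l i \<omega> *\<^sub>R (\<omega> - x i)) + L *\<^sub>R (x i - x' i)"
      unfolding L_def scaleR_sum_left sum.distrib[symmetric] by (intro sum.cong) (auto simp: algebra_simps)
    then have "e' i - v - (\<Sum>\<omega>\<in>T i. l i \<omega> *\<^sub>R (\<omega> - x' i))
      = (e i - v - (\<Sum>\<omega>\<in>T i. l i \<omega> *\<^sub>R (\<omega> - x i))) - ((e i - e' i) + L *\<^sub>R (x i - x' i))"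
      by (simp add: algebra_simps)
    then have "norm (e' i - v - (\<Sum>\<omega>\<in>T i. l i \<omega> *\<^sub>R (\<omega> - x' i)))
      \<le> norm (e i - v - (\<Sum>\<omega>\<in>T i. l i \<omega> *\<^sub>R (\<omega> - x i))) + norm ((e i - e' i) + L *\<^sub>R (x i - x' i))"
      by (simp only: norm_triangle_ineq4)
    also have "norm ((e i - e' i) + L *\<^sub>R (x i - x' i)) \<le> norm (e i - e' i) + L * norm (x i - x' i)"
      using norm_triangle_ineq[of "e i - e' i" "L *\<^sub>R (x i - x' i)"] L(1) by simp
    also have "\<dots> \<le> \<theta> + M * \<theta>"
      using mult_left_mono[OF near(1)[OF i] L(1)] near(2)[OF i] L\<theta> by linarith
    finally have A: "norm (e' i - v - (\<Sum>\<omega>\<in>T i. l i \<omega> *\<^sub>R (\<omega> - x' i)))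
      \<le> norm (e i - v - (\<Sum>\<omega>\<in>T i. l i \<omega> *\<^sub>R (\<omega> - x i))) + (\<theta> + M * \<theta>)" by simp
    have "(\<Sum>\<omega>\<in>T i. l i \<omega> * norm (\<omega> - x' i)) \<le> (\<Sum>\<omega>\<in>T i. l i \<omega> * (norm (\<omega> - x i) + \<theta>))"
      using l move[OF i] by (intro sum_mono mult_left_mono) auto
    also have "\<dots> = (\<Sum>\<omega>\<in>T i. l i \<omega> * norm (\<omega> - x i)) + L * \<theta>"
      by (simp add: L_def distrib_left sum.distrib sum_distrib_right)
    finally have "(\<Sum>\<omega>\<in>T i. l i \<omega> * norm (\<omega> - x' i)) \<le> (\<Sum>\<omega>\<in>T i. l i \<omega> * norm (\<omega> - x i)) + M * \<theta>"
      using L\<theta> by linarith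
    then have "\<epsilon> * (\<Sum>\<omega>\<in>T i. l i \<omega> * norm (\<omega> - x' i)) \<le> \<epsilon> * ((\<Sum>\<omega>\<in>T i. l i \<omega> * norm (\<omega> - x i)) + M * \<theta>)"
      using \<epsilon> by (intro mult_left_mono)
    then show "norm (e' i - v - (\<Sum>\<omega>\<in>T i. l i \<omega> *\<^sub>R (\<omega> - x' i))) + \<epsilon> * (\<Sum>\<omega>\<in>T i. l i \<omega> * norm (\<omega> - x' i))
      \<le> norm (e i - v - (\<Sum>\<omega>\<in>T i. l i \<omega> *\<^sub>R (\<omega> - x i))) + \<epsilon> * (\<Sum>\<omega>\<in>T i. l i \<omega> * norm (\<omega> - x i)) + (1 + M * (1 + \<epsilon>)) * \<theta>"
      using A by (simp add: algebra_simps)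
  qed
  also have "\<dots> = normal_gap I \<epsilon> x e v T l + card I * (1 + M * (1 + \<epsilon>)) * \<theta>"
    by (simp add: normal_gap_def sum.distrib)
  finally show "normal_gap I \<epsilon> x' e' v T l \<le> normal_gap I \<epsilon> x e v T l + card I * (1 + M * (1 + \<epsilon>)) * \<theta>" .
qed

section \<open>A separable subspace closed under choosing witnesses\<close>

text \<open>The closure step is iterated countably often. Families are extensional on the finite set
  \<open>I\<close>, so a countable set carries only countably many of them, and a family in the
  union of the increasing levels already lies in one level.\<close>

lemma countable_skolem_hull:
  fixes W :: "('i \<Rightarrow> 'a::real_vector) \<Rightarrow> ('i \<Rightarrow> 'a) \<Rightarrow> 'k::countable \<Rightarrow> 'a set"
  assumes I: "finite I" and W: "\<And>x e k. countable (W x e k)" and S: "countable S"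
  obtains D where "countable D" "S \<subseteq> D"
    "\<And>x y q r. x \<in> D \<Longrightarrow> y \<in> D \<Longrightarrow> q \<in> \<rat> \<Longrightarrow> r \<in> \<rat> \<Longrightarrow> q *\<^sub>R x + r *\<^sub>R y \<in> D"
    "\<And>x e k. x \<in> I \<rightarrow>\<^sub>E D \<Longrightarrow> e \<in> I \<rightarrow>\<^sub>E D \<Longrightarrow> W x e k \<subseteq> D"
proof -
  define step where "step D = D \<union> (\<Union>x\<in>D. \<Union>y\<in>D. \<Union>q\<in>\<rat>. \<Union>r\<in>\<rat>. {q *\<^sub>R x + r *\<^sub>R y})
     \<union> (\<Union>x\<in>I \<rightarrow>\<^sub>E D. \<Union>e\<in>I \<rightarrow>\<^sub>E D. \<Union>k. W x e k)" for D
  define Ds where "Ds k = (step ^^ k) S" for k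
  have Suc: "Ds (Suc k) = step (Ds k)" for k by (simp add: Ds_def)
  have cnt: "countable (Ds k)" for k
  proof (induction k)
    case 0
    then show ?case using S by (simp add: Ds_def)
  next
    case (Suc k)
    have "countable (I \<rightarrow>\<^sub>E Ds k)" using I Suc by (intro countable_PiE) auto
    moreover note \<open>countable (Ds k)\<close> W countable_rat
    ultimately have "countable (step (Ds k))" unfolding step_def
      by (intro countable_Un countable_UN) simp_all
    then show ?case by (simp add: Ds_def)
  qed
  have mono: "Ds k \<subseteq> Ds j" if "k \<le> j" for k j
    using that
  proof (induction j rule: dec_induct)
    case (step j)
    have "Ds j \<subseteq> Ds (Suc j)" unfolding Suc step_def by auto
    with step show ?case by blast
  qed simp
  have level: "\<exists>k. x \<in> I \<rightarrow>\<^sub>E Ds k" if x: "x \<in> I \<rightarrow>\<^sub>E (\<Union>k. Ds k)" for x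
  proof -
    have "\<forall>i\<in>I. \<exists>k. x i \<in> Ds k" using x by auto
    then obtain h where h: "\<And>i. i \<in> I \<Longrightarrow> x i \<in> Ds (h i)" by metis
    have "x i \<in> Ds (Max (h ` I))" if "i \<in> I" for i
    proof -
      have "h i \<le> Max (h ` I)" using I that by auto
      then show ?thesis using h[OF that] mono by blast
    qed
    then show ?thesis using x by (auto simp: PiE_iff)
  qed
  show ?thesis
  proof (rule that[of "\<Union>k. Ds k"])
    show "countable (\<Union>k. Ds k)" using cnt by auto
    have "Ds 0 = S" by (simp add: Ds_def)
    then show "S \<subseteq> (\<Union>k. Ds k)" by blast
    show "q *\<^sub>R x + r *\<^sub>R y \<in> (\<Union>k. Ds k)" if xy: "x \<in> (\<Union>k. Ds k)" "y \<in> (\<Union>k. Ds k)" and qr: "q \<in> \<rat>" "r \<in> \<rat>" for x y q r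
    proof -
      obtain k j where "x \<in> Ds k" "y \<in> Ds j" using xy by blast
      then have "x \<in> Ds (max k j)" "y \<in> Ds (max k j)" using mono[of k "max k j"] mono[of j "max k j"] by auto
      then have "q *\<^sub>R x + r *\<^sub>R y \<in> Ds (Suc (max k j))" unfolding Suc step_def using qr by blast
      then show ?thesis by blast
    qed
    fix x e k assume xe: "x \<in> I \<rightarrow>\<^sub>E (\<Union>k. Ds k)" "e \<in> I \<rightarrow>\<^sub>E (\<Union>k. Ds k)"
    obtain a where a: "x \<in> I \<rightarrow>\<^sub>E Ds a" using level[OF xe(1)] by blast
    obtain b where b: "e \<in> I \<rightarrow>\<^sub>E Ds b" using level[OF xe(2)] by blast
    from a b have ab: "x \<in> I \<rightarrow>\<^sub>E Ds (max a b)" "e \<in> I \<rightarrow>\<^sub>E Ds (max a b)"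
      using PiE_mono[of I "\<lambda>_. Ds a" "\<lambda>_. Ds (max a b)"] PiE_mono[of I "\<lambda>_. Ds b" "\<lambda>_. Ds (max a b)"]
        mono[of a "max a b"] mono[of b "max a b"] by (meson max.cobounded1 max.cobounded2 subsetD)+
    have "W x e k \<subseteq> step (Ds (max a b))"
      unfolding step_def
    proof (rule le_supI2)
      have "W x e k \<subseteq> (\<Union>k. W x e k)" by (rule UN_upper) simp
      also have "\<dots> \<subseteq> (\<Union>e\<in>I \<rightarrow>\<^sub>E Ds (max a b). \<Union>k. W x e k)" by (rule UN_upper[OF ab(2)])
      also have "\<dots> \<subseteq> (\<Union>x\<in>I \<rightarrow>\<^sub>E Ds (max a b). \<Union>e\<in>I \<rightarrow>\<^sub>E Ds (max a b). \<Union>k. W x e k)"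
        by (rule UN_upper[OF ab(1)])
      finally show "W x e k \<subseteq> \<dots>" .
    qed
    then have "W x e k \<subseteq> Ds (Suc (max a b))" by (simp only: Suc)
    then show "W x e k \<subseteq> (\<Union>k. Ds k)" by blast
  qed
qed

lemma subspace_closure_rational:
  fixes D :: "'a::real_normed_vector set"
  assumes ne: "D \<noteq> {}"
    and D: "\<And>x y q r. x \<in> D \<Longrightarrow> y \<in> D \<Longrightarrow> q \<in> \<rat> \<Longrightarrow> r \<in> \<rat> \<Longrightarrow> q *\<^sub>R x + r *\<^sub>R y \<in> D"
  shows "subspace (closure D)"
proof -
  obtain d where d: "d \<in> D" using ne by blast
  show ?thesis
    unfolding subspace_def
  proof (intro conjI ballI allI)
    have "0 \<in> D" using D[OF d d, of 0 0] by simp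
    then show "0 \<in> closure D" using closure_subset by blast
  next
    fix x y assume "x \<in> closure D" "y \<in> closure D"
    then obtain a b where a: "\<And>k. a k \<in> D" "a \<longlonglongrightarrow> x" and b: "\<And>k. b k \<in> D" "b \<longlonglongrightarrow> y"
      unfolding closure_sequential by blast
    have "a k + b k \<in> D" for k using D[OF a(1) b(1), of 1 1] by simp
    moreover have "(\<lambda>k. a k + b k) \<longlonglongrightarrow> x + y" by (intro tendsto_intros a b)
    ultimately show "x + y \<in> closure D"
      unfolding closure_sequential by (intro exI[of _ "\<lambda>k. a k + b k"]) simp
  next
    fix c :: real and x assume "x \<in> closure D"
    then obtain a where a: "\<And>k. a k \<in> D" "a \<longlonglongrightarrow> x" unfolding closure_sequential by blast
    have "c \<in> closure \<rat>" by (simp add: Rats_closure_real)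
    then obtain q where q: "\<And>k. q k \<in> \<rat>" "q \<longlonglongrightarrow> c" unfolding closure_sequential by blast
    have "q k *\<^sub>R a k \<in> D" for k using D[OF a(1) a(1) q(1), of 0] by simp
    moreover have "(\<lambda>k. q k *\<^sub>R a k) \<longlonglongrightarrow> c *\<^sub>R x" by (intro tendsto_intros a q)
    ultimately show "c *\<^sub>R x \<in> closure D"
      unfolding closure_sequential by (intro exI[of _ "\<lambda>k. q k *\<^sub>R a k"]) simp
  qed
qed

text \<open>A countable set \<open>D\<close> is closed under witnesses for rational radii, rational
  gap bounds and natural bounds on the coefficients, and \<open>Y\<close> is its closure. Points of
  \<open>Y\<close> are approximated by points of \<open>D\<close>, a witness is found for these, and
  it is carried back. The room between \<open>\<delta>'\<close> and \<open>\<delta>\<close> and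
  between \<open>c'\<close> and \<open>c\<close> absorbs both moves.\<close>

lemma separable_reduction:
  fixes \<Omega> :: "'i \<Rightarrow> 'a::real_normed_vector set"
  assumes I: "finite I" and \<epsilon>: "\<epsilon> \<ge> 0" and S: "countable S"
  obtains Y where "closed Y" "subspace Y" "separable_space (top_of_set Y)" "S \<subseteq> Y"
    "\<And>x e \<delta>' \<delta> c' c v T l. \<forall>i\<in>I. x i \<in> Y \<and> e i \<in> Y \<Longrightarrow> \<delta>' < \<delta> \<Longrightarrow> c' < c \<Longrightarrow>
      feasible I x \<delta>' T l \<Longrightarrow> \<forall>i\<in>I. T i \<subseteq> \<Omega> i \<Longrightarrow> normal_gap I \<epsilon> x e v T l < c' \<Longrightarrow>
      \<exists>v T l. feasible I x \<delta> T l \<and> (\<forall>i\<in>I. T i \<subseteq> \<Omega> i \<inter> Y) \<and> normal_gap I \<epsilon> x e v T l < c"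
proof -
  \<comment> \<open>The code \<open>k\<close> ranges over a countable type. Its component
    \<open>M\<close> makes the later perturbation uniform over all witnesses of that code.\<close>
  define P where "P x e k T \<longleftrightarrow> (case k of (d, s, M) \<Rightarrow> \<exists>v l. feasible I x (real_of_rat d) T l \<and> (\<forall>i\<in>I. T i \<subseteq> \<Omega> i \<and> sum (l i) (T i) \<le> real M)
     \<and> normal_gap I \<epsilon> x e v T l < real_of_rat s)" for x e :: "'i \<Rightarrow> 'a" and k :: "rat \<times> rat \<times> nat" and T
  define W where "W x e k = (if \<exists>T. P x e k T then \<Union>i\<in>I. (SOME T. P x e k T) i else {})" for x e k
  have W: "\<exists>T. P x e k T \<and> (\<forall>i\<in>I. T i \<subseteq> W x e k)" if "\<exists>T. P x e k T" for x e k
    using someI_ex[OF that] that by (auto simp: W_def)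
  have cW: "countable (W x e k)" for x e k
  proof (cases "\<exists>T. P x e k T")
    case True
    then have "P x e k (SOME T. P x e k T)" by (rule someI_ex)
    then have "countable ((SOME T. P x e k T) i)" if "i \<in> I" for i
      using that by (auto simp: P_def feasible_def intro: countable_finite split: prod.splits)
    moreover have "countable I" using I by (rule countable_finite)
    ultimately show ?thesis using True by (simp add: W_def)
  qed (simp add: W_def)
  obtain D where D: "countable D" "insert 0 S \<subseteq> D"
    "\<And>x y q r. x \<in> D \<Longrightarrow> y \<in> D \<Longrightarrow> q \<in> \<rat> \<Longrightarrow> r \<in> \<rat> \<Longrightarrow> q *\<^sub>R x + r *\<^sub>R y \<in> D"
    "\<And>x e k. x \<in> I \<rightarrow>\<^sub>E D \<Longrightarrow> e \<in> I \<rightarrow>\<^sub>E D \<Longrightarrow> W x e k \<subseteq> D"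
    using countable_skolem_hull[where W = W, OF I cW countable_insert[OF S, of 0]] by blast
  have DY: "D \<subseteq> closure D" by (rule closure_subset)
  show ?thesis
  proof (rule that[of "closure D"])
    show "subspace (closure D)" using D(2,3) by (intro subspace_closure_rational) auto
    show "separable_space (top_of_set (closure D))"
      unfolding separable_space_def using D(1) DY
      by (intro exI[of _ D]) (auto simp: closure_of_subtopology Int_absorb1)
    show "S \<subseteq> closure D" using D(2) DY by auto
    fix x e \<delta>' \<delta> c' c v T l
    assume xe: "\<forall>i\<in>I. x i \<in> closure D \<and> e i \<in> closure D" and \<delta>: "\<delta>' < \<delta>" and c: "c' < c"
      and f: "feasible I x \<delta>' T l" and T: "\<forall>i\<in>I. T i \<subseteq> \<Omega> i" and g: "normal_gap I \<epsilon> x e v T l < c'"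
    obtain qd d where d: "\<delta>' < d" "d < \<delta>" "d = real_of_rat qd" using of_rat_dense[OF \<delta>] by blast
    obtain qs s where s: "c' < s" "s < c" "s = real_of_rat qs" using of_rat_dense[OF c] by blast
    obtain M :: nat where M: "(\<Sum>i\<in>I. \<bar>sum (l i) (T i)\<bar>) \<le> real M" using real_arch_simple by blast
    have lM: "sum (l i) (T i) \<le> real M" if "i \<in> I" for i
    proof -
      have "\<bar>sum (l i) (T i)\<bar> \<le> (\<Sum>i\<in>I. \<bar>sum (l i) (T i)\<bar>)" using I that by (intro member_le_sum) auto
      then show ?thesis using M by linarith
    qed
    define K where "K = card I * (1 + real M * (1 + \<epsilon>))"
    have K: "K \<ge> 0" using \<epsilon> by (simp add: K_def)
    \<comment> \<open>The rationals \<open>d\<close> and \<open>s\<close> split the available room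
      into one part for the move into \<open>D\<close> and one for the move back. \<open>K\<close>
      is the constant of \<open>normal_gap_perturb\<close>; \<open>K + 1\<close> keeps the divisor
      positive.\<close>
    define \<theta> where "\<theta> = min (min (d - \<delta>') (\<delta> - d)) (min ((s - c') / (K + 1)) ((c - s) / (K + 1)))"
    have \<theta>: "\<theta> > 0" using d s K by (simp add: \<theta>_def)
    have "\<theta> \<le> d - \<delta>'" "\<theta> \<le> \<delta> - d" and le: "\<theta> \<le> (s - c') / (K + 1)" "\<theta> \<le> (c - s) / (K + 1)"
      by (simp_all add: \<theta>_def min_le_iff_disj)
    then have \<theta>d: "\<delta>' + \<theta> \<le> d" "d + \<theta> \<le> \<delta>" by linarith+
    have "K + 1 > 0" using K by simp
    then have "(K + 1) * \<theta> \<le> s - c'" "(K + 1) * \<theta> \<le> c - s"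
      using le by (simp_all add: pos_le_divide_eq mult.commute)
    then have \<theta>s: "c' + K * \<theta> \<le> s" "s + K * \<theta> \<le> c" using \<theta> by (simp_all add: distrib_right)
    have "\<exists>z'\<in>D. norm (z' - z) < \<theta>" if "z \<in> closure D" for z
      using that \<theta> by (simp add: closure_approachable dist_norm)
    then obtain r where r: "\<And>z. z \<in> closure D \<Longrightarrow> r z \<in> D \<and> norm (r z - z) < \<theta>" by metis
    define x' where "x' = restrict (\<lambda>i. r (x i)) I"
    define e' where "e' = restrict (\<lambda>i. r (e i)) I"
    have D': "x' \<in> I \<rightarrow>\<^sub>E D" "e' \<in> I \<rightarrow>\<^sub>E D" using r xe by (auto simp: x'_def e'_def)
    have near: "norm (x i - x' i) \<le> \<theta>" "norm (e i - e' i) \<le> \<theta>" if "i \<in> I" for i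
      using r xe that by (auto simp: x'_def e'_def norm_minus_commute less_imp_le)
    note n = normal_gap_perturb[where e = e and e' = e', OF f \<epsilon> lM near]
    have "P x' e' (qd, qs, M) T"
    proof -
      have "feasible I x' d T l" using n(1) \<theta>d(1) by (force simp: feasible_def)
      moreover have "normal_gap I \<epsilon> x' e' v T l < s" using n(2)[where v = v] g \<theta>s(1) by (simp add: K_def)
      ultimately show ?thesis unfolding P_def prod.case d(3) s(3) using T lM by blast
    qed
    then obtain T' where T': "P x' e' (qd, qs, M) T'" "\<forall>i\<in>I. T' i \<subseteq> W x' e' (qd, qs, M)" using W by blast
    then obtain v' l' where v': "feasible I x' d T' l'" "\<And>i. i \<in> I \<Longrightarrow> T' i \<subseteq> \<Omega> i" "\<And>i. i \<in> I \<Longrightarrow> sum (l' i) (T' i) \<le> real M"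
      "normal_gap I \<epsilon> x' e' v' T' l' < s" by (auto simp: P_def d(3) s(3))
    have near': "norm (x' i - x i) \<le> \<theta>" "norm (e' i - e i) \<le> \<theta>" if "i \<in> I" for i
      using near[OF that] by (simp_all add: norm_minus_commute)
    note n' = normal_gap_perturb[where e = e' and e' = e, OF v'(1) \<epsilon> v'(3) near']
    have "feasible I x \<delta> T' l'" using n'(1) \<theta>d(2) by (force simp: feasible_def)
    moreover have "normal_gap I \<epsilon> x e v' T' l' < c" using n'(2)[where v = v'] v'(4) \<theta>s(2) by (simp add: K_def)
    moreover have "T' i \<subseteq> \<Omega> i \<inter> closure D" if "i \<in> I" for i
      using v'(2)[OF that] T'(2) D(4)[OF D'] DY that by blast
    ultimately show "\<exists>v T l. feasible I x \<delta> T l \<and> (\<forall>i\<in>I. T i \<subseteq> \<Omega> i \<inter> closure D) \<and> normal_gap I \<epsilon> x e v T l < c"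
      by blast
  qed simp
qed

section \<open>The extremal principle\<close>

text \<open>Weak duality, the easy converse of \<open>normal_multipliers\<close>: the term
  \<open>v\<close> disappears because the functionals sum to 0, and the coefficients
  \<open>l\<close> are paid for by the normality inequalities.\<close>

lemma normal_gap_ge_pairing:
  fixes xs :: "'i \<Rightarrow> 'a::real_normed_vector \<Rightarrow>\<^sub>L real"
  assumes f: "feasible I x \<delta> T l"
    and xs: "(\<Sum>i\<in>I. xs i) = 0" "\<And>i. i \<in> I \<Longrightarrow> norm (xs i) \<le> 1"
    and normal: "\<And>i \<omega>. i \<in> I \<Longrightarrow> \<omega> \<in> T i \<Longrightarrow> blinfun_apply (xs i) (\<omega> - x i) \<le> \<epsilon> * norm (\<omega> - x i)"
  shows "(\<Sum>i\<in>I. blinfun_apply (xs i) (e i)) \<le> normal_gap I \<epsilon> x e v T l"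
proof -
  have "blinfun_apply (xs i) (e i) \<le> norm (e i - v - (\<Sum>\<omega>\<in>T i. l i \<omega> *\<^sub>R (\<omega> - x i)))
      + \<epsilon> * (\<Sum>\<omega>\<in>T i. l i \<omega> * norm (\<omega> - x i)) + blinfun_apply (xs i) v" if i: "i \<in> I" for i
  proof -
    define g where "g = e i - v - (\<Sum>\<omega>\<in>T i. l i \<omega> *\<^sub>R (\<omega> - x i))"
    have "\<bar>xs i g\<bar> \<le> norm (xs i) * norm g" using norm_blinfun[of "xs i" g] by simp
    also have "\<dots> \<le> 1 * norm g" by (intro mult_right_mono xs i) auto
    finally have "xs i g \<le> norm g" by simp
    moreover have "xs i g = xs i (e i) - xs i v - (\<Sum>\<omega>\<in>T i. l i \<omega> * xs i (\<omega> - x i))"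
      by (simp add: g_def blinfun.diff_right blinfun.sum_right blinfun.scaleR_right)
    moreover have "(\<Sum>\<omega>\<in>T i. l i \<omega> * xs i (\<omega> - x i)) \<le> (\<Sum>\<omega>\<in>T i. l i \<omega> * (\<epsilon> * norm (\<omega> - x i)))"
      using f i normal[OF i] by (intro sum_mono mult_left_mono) (auto simp: feasible_def)
    moreover have "(\<Sum>\<omega>\<in>T i. l i \<omega> * (\<epsilon> * norm (\<omega> - x i))) = \<epsilon> * (\<Sum>\<omega>\<in>T i. l i \<omega> * norm (\<omega> - x i))"
      by (simp add: sum_distrib_left mult.left_commute)
    ultimately show ?thesis unfolding g_def by linarith
  qed
  then have "(\<Sum>i\<in>I. blinfun_apply (xs i) (e i)) \<le> normal_gap I \<epsilon> x e v T l + (\<Sum>i\<in>I. blinfun_apply (xs i) v)"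
    unfolding normal_gap_def sum.distrib[symmetric] by (rule sum_mono)
  moreover have "(\<Sum>i\<in>I. blinfun_apply (xs i) v) = 0"
    using xs(1) by (simp add: blinfun.sum_left[symmetric])
  ultimately show ?thesis by simp
qed

text \<open>Ekeland's principle minimizes the scale \<open>r\<close> of admissible pairs, starting
  from \<open>xbar\<close> at scale \<open>r0\<close>. At the resulting point, moving the points by
  \<open>s\<close> cannot make a decrease of the scale by more than \<open>\<kappa> * s\<close>
  admissible. Expanding the bumps turns this into a lower bound on the variation of their
  derivatives; dividing these by their total weight \<open>\<Lambda>\<close> gives the functionals,
  so \<open>5 * \<kappa>\<close> is an error relative to a pairing of at least 1/4.\<close>

lemma extremal_normals_separable_dual:
  fixes W :: "'i \<Rightarrow> 'a::banach set"
  assumes I: "finite I" "i0 \<in> I"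
    and Y: "subspace Y" "separable_space (Metric_space.mtopology (dual_on Y) (dual_dist Y))"
    and W: "\<And>i. i \<in> I \<Longrightarrow> closed (W i)" "\<And>i. i \<in> I \<Longrightarrow> W i \<subseteq> Y" "\<And>i. i \<in> I \<Longrightarrow> xbar \<in> W i"
    and aY: "\<And>i. i \<in> I \<Longrightarrow> a i \<in> Y"
    and apart: "\<And>x. \<forall>i\<in>I. x i \<in> W i \<Longrightarrow> \<exists>i\<in>I. x i - a i \<noteq> x i0 - a i0"
    and r0: "r0 > 0" "\<And>i. i \<in> I \<Longrightarrow> 2 * norm (a i - a i0) \<le> r0"
    and \<kappa>: "\<kappa> > 0" "\<kappa> \<le> 1/4"
  obtains x e and xs :: "'i \<Rightarrow> 'a \<Rightarrow>\<^sub>L real" and \<delta> where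
    "\<And>i. i \<in> I \<Longrightarrow> x i \<in> W i" "\<And>i. i \<in> I \<Longrightarrow> norm (x i - xbar) \<le> r0 / \<kappa>"
    "\<And>i. i \<in> I \<Longrightarrow> e i \<in> Y" "\<And>i. i \<in> I \<Longrightarrow> norm (e i) \<le> 1"
    "(\<Sum>i\<in>I. xs i) = 0" "\<And>i. i \<in> I \<Longrightarrow> norm (xs i) \<le> 1" "(\<Sum>i\<in>I. blinfun_apply (xs i) (e i)) \<ge> 1/4"
    "\<delta> > 0" "\<And>i \<omega>. i \<in> I \<Longrightarrow> \<omega> \<in> W i \<Longrightarrow> norm (\<omega> - x i) < \<delta> \<Longrightarrow>
       blinfun_apply (xs i) (\<omega> - x i) \<le> 5 * \<kappa> * norm (\<omega> - x i)"
proof -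
  define J where "J = I - {i0}"
  have J: "finite J" "J \<subseteq> I" "i0 \<notin> J" "I = insert i0 J" using I by (auto simp: J_def)
  obtain \<Phi> :: "nat \<Rightarrow> 'a \<Rightarrow> real" where \<Phi>: "\<And>N. continuous_on UNIV (\<Phi> N)" "\<And>N z. \<Phi> N z \<ge> 0"
    "\<And>N z. norm z \<le> 1/2 \<Longrightarrow> \<Phi> N z = 0"
    "\<And>z. norm z \<ge> 1 \<Longrightarrow> \<exists>N. \<Phi> N z \<ge> 1"
    "\<And>\<rho>. \<rho> < 1 \<Longrightarrow> \<exists>N. \<forall>M z. norm z \<le> \<rho> \<longrightarrow> \<Phi> M z \<le> \<Phi> N z"
    "\<And>N z. z \<in> Y \<Longrightarrow> norm z \<le> 1 \<Longrightarrow> \<exists>(f :: 'a \<Rightarrow>\<^sub>L real) \<Lambda> K. \<Lambda> \<ge> 0 \<and> K \<ge> 0 \<and> (\<Phi> N z > 0 \<longrightarrow> \<Lambda> > 0) \<and>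
       norm f \<le> \<Lambda> \<and> blinfun_apply f z \<ge> \<Lambda> / 4 \<and>
       (\<forall>h\<in>Y. \<Phi> N (z + h) \<le> \<Phi> N z + blinfun_apply f h + \<kappa> * \<Lambda> * norm h + K * (norm h)\<^sup>2)"
    using almost_smooth_bump[OF Y \<kappa>] by blast
  \<comment> \<open>Differences to the shifted point of the reference index \<open>i0\<close>;
    \<open>apart\<close> says that they never vanish simultaneously on the sets.\<close>
  define y where "y x i = x i - a i - (x i0 - a i0)" for x i
  \<comment> \<open>Quantifying over all \<open>N\<close> makes the sum of the possibly infinite limits of \<open>\<Phi> N\<close> at most 1/2.\<close>
  define adm where "adm x r \<longleftrightarrow> (\<forall>i\<in>I. x i \<in> W i) \<and> r > 0 \<and> (\<forall>N. (\<Sum>i\<in>J. \<Phi> N (y x i /\<^sub>R r)) \<le> 1/2)" for x r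
  \<comment> \<open>The scale is left out of the distance: it is the function being
    minimized.\<close>
  define d where "d p p' = (\<Sum>i\<in>I. norm (fst p i - fst p' i))" for p p' :: "('i \<Rightarrow> 'a) \<times> real"
  have y_less: "norm (y x i) < r" if "adm x r" "i \<in> J" for x r i
  proof (rule ccontr)
    assume "\<not> ?thesis"
    then have "norm (y x i /\<^sub>R r) \<ge> 1" using that by (simp add: adm_def field_simps)
    then obtain N where "\<Phi> N (y x i /\<^sub>R r) \<ge> 1" using \<Phi>(4) by blast
    moreover have "\<Phi> N (y x i /\<^sub>R r) \<le> (\<Sum>i\<in>J. \<Phi> N (y x i /\<^sub>R r))"
      using J that \<Phi>(2) by (intro member_le_sum) auto
    moreover have "(\<Sum>i\<in>J. \<Phi> N (y x i /\<^sub>R r)) \<le> 1/2" using that by (auto simp: adm_def)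
    ultimately show False by simp
  qed
  have d_coord: "norm (fst p i - fst p' i) \<le> d p p'" if "i \<in> I" for p p' i
    unfolding d_def using I that by (intro member_le_sum) auto
  have "\<exists>p\<in>{(x, r). adm x r}. (\<lambda>k. d (u k) p) \<longlonglongrightarrow> 0 \<and> (\<forall>k. snd p \<le> snd (u k))"
    if u: "\<And>k. u k \<in> {(x, r). adm x r}" and dec: "decseq (\<lambda>k. snd (u k))"
      and cau: "\<And>e. e > 0 \<Longrightarrow> \<exists>K. \<forall>k\<ge>K. \<forall>j\<ge>k. d (u k) (u j) < e" for u :: "nat \<Rightarrow> ('i \<Rightarrow> 'a) \<times> real"
  proof -
    define xk where "xk k = fst (u k)" for k
    define rk where "rk k = snd (u k)" for k
    have adm: "adm (xk k) (rk k)" for k using u[of k] by (auto simp: xk_def rk_def)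
    have "\<exists>l. (\<lambda>k. xk k i) \<longlonglongrightarrow> l" if i: "i \<in> I" for i
    proof -
      have "Cauchy (\<lambda>k. xk k i)"
      proof (rule CauchyI')
        fix e :: real assume "e > 0"
        then obtain K where K: "\<forall>k\<ge>K. \<forall>j\<ge>k. d (u k) (u j) < e" using cau by blast
        have "norm (xk m i - xk n i) < e" if "m \<ge> K" "n > m" for m n
        proof -
          have "d (u m) (u n) < e" using K that by auto
          then show ?thesis using d_coord[OF i, of "u m" "u n"] by (simp add: xk_def)
        qed
        then show "\<exists>M. \<forall>m\<ge>M. \<forall>n>m. dist (xk m i) (xk n i) < e" unfolding dist_norm by blast
      qed
      then show ?thesis using Cauchy_convergent convergent_def by blast
    qed
    then obtain X where X: "\<And>i. i \<in> I \<Longrightarrow> (\<lambda>k. xk k i) \<longlonglongrightarrow> X i" by metis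
    have "\<forall>k. 0 \<le> rk k" using adm by (simp add: adm_def less_imp_le)
    then obtain r where r: "rk \<longlonglongrightarrow> r" "\<And>k. r \<le> rk k"
      using decseq_convergent[of rk 0] dec unfolding rk_def by blast
    have XW: "X i \<in> W i" if "i \<in> I" for i
      using closed_sequentially[OF W(1)[OF that] _ X[OF that]] adm that by (auto simp: adm_def)
    have yX: "(\<lambda>k. y (xk k) i) \<longlonglongrightarrow> y X i" if "i \<in> I" for i
      unfolding y_def by (intro tendsto_intros X that I)
    \<comment> \<open>Extremality enters here: some difference of the limit points is nonzero, and
      since it is bounded by the limit scale, that scale cannot be 0.\<close>
    obtain i where i: "i \<in> I" "X i - a i \<noteq> X i0 - a i0" using apart XW by blast
    then have iJ: "i \<in> J" "y X i \<noteq> 0" by (auto simp: J_def y_def)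
    have "norm (y X i) \<le> r"
    proof (rule LIMSEQ_le)
      show "(\<lambda>k. norm (y (xk k) i)) \<longlonglongrightarrow> norm (y X i)" by (intro tendsto_norm yX i)
      show "\<exists>N. \<forall>n\<ge>N. norm (y (xk n) i) \<le> rk n" using y_less[OF adm iJ(1)] less_imp_le by blast
    qed (rule r)
    then have rpos: "r > 0" using iJ(2) by (smt (verit) norm_le_zero_iff)
    have "(\<Sum>i\<in>J. \<Phi> N (y X i /\<^sub>R r)) \<le> 1/2" for N
    proof (rule LIMSEQ_le_const2)
      show "(\<lambda>k. \<Sum>i\<in>J. \<Phi> N (y (xk k) i /\<^sub>R rk k)) \<longlonglongrightarrow> (\<Sum>i\<in>J. \<Phi> N (y X i /\<^sub>R r))"
      proof (rule tendsto_sum)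
        fix i assume "i \<in> J"
        then have "(\<lambda>k. y (xk k) i /\<^sub>R rk k) \<longlonglongrightarrow> y X i /\<^sub>R r"
          using J rpos by (intro tendsto_intros yX r) auto
        then show "(\<lambda>k. \<Phi> N (y (xk k) i /\<^sub>R rk k)) \<longlonglongrightarrow> \<Phi> N (y X i /\<^sub>R r)"
          by (intro continuous_on_tendsto_compose[OF \<Phi>(1)]) auto
      qed
      show "\<exists>K. \<forall>k\<ge>K. (\<Sum>i\<in>J. \<Phi> N (y (xk k) i /\<^sub>R rk k)) \<le> 1/2" using adm by (auto simp: adm_def)
    qed
    then have "adm X r" using XW rpos by (auto simp: adm_def)
    moreover have "(\<lambda>k. d (u k) (X, r)) \<longlonglongrightarrow> (\<Sum>i\<in>I. norm (X i - X i))"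
      unfolding d_def fst_conv xk_def[symmetric] by (intro tendsto_intros X)
    ultimately show ?thesis using r(2) by (intro bexI[of _ "(X, r)"]) (auto simp: rk_def)
  qed
  note complete = this
  \<comment> \<open>At the constant family the differences are those of the shifts, of norm at most
    \<open>r0 / 2\<close>, where all bumps vanish.\<close>
  have "adm (\<lambda>_. xbar) r0"
    unfolding adm_def
  proof (intro conjI ballI allI)
    fix N
    have "\<Phi> N (y (\<lambda>_. xbar) i /\<^sub>R r0) = 0" if "i \<in> J" for i
    proof (rule \<Phi>(3))
      have "norm (a i0 - a i) \<le> r0 / 2" using r0(2)[of i] that J by (auto simp: norm_minus_commute)
      moreover have "y (\<lambda>_. xbar) i = a i0 - a i" by (simp add: y_def)
      ultimately have "norm (y (\<lambda>_. xbar) i) \<le> r0 / 2" by simp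
      then show "norm (y (\<lambda>_. xbar) i /\<^sub>R r0) \<le> 1/2"
        using r0(1) unfolding norm_scaleR by (simp add: field_simps)
    qed
    then show "(\<Sum>i\<in>J. \<Phi> N (y (\<lambda>_. xbar) i /\<^sub>R r0)) \<le> 1/2" by simp
  qed (use W r0 in auto)
  then have start: "(\<lambda>_. xbar, r0) \<in> {(x, r). adm x r}" by simp
  have d_tri: "d p p'' \<le> d p p' + d p' p''" for p p' p''
    unfolding d_def sum.distrib[symmetric] by (intro sum_mono) (rule norm_diff_triangle_le, auto)
  obtain p where p: "p \<in> {(x, r). adm x r}" "snd p + \<kappa> * d (\<lambda>_. xbar, r0) p \<le> snd (\<lambda>_. xbar, r0)"
    "\<And>p'. p' \<in> {(x, r). adm x r} \<Longrightarrow> snd p' \<ge> snd p - \<kappa> * d p p'"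
    by (rule ekeland[where d = d and S = "{(x, r). adm x r}" and \<phi> = snd and \<eta> = \<kappa>, OF _ _ d_tri \<kappa>(1) _ complete start])
      (auto simp: d_def adm_def intro: sum_nonneg)
  obtain x r where xr: "p = (x, r)" by (cases p)
  have adm: "adm x r" using p(1) xr by simp
  then have r: "r > 0" and xW: "\<And>i. i \<in> I \<Longrightarrow> x i \<in> W i" by (auto simp: adm_def)
  have minimal: "r' \<ge> r - \<kappa> * (\<Sum>i\<in>I. norm (x i - x' i))" if "adm x' r'" for x' r'
    using p(3)[of "(x', r')"] that by (simp add: xr d_def)
  have close: "norm (x i - xbar) \<le> r0 / \<kappa>" if "i \<in> I" for i
  proof -
    have "norm (xbar - x i) \<le> d (\<lambda>_. xbar, r0) p" using d_coord[OF that, of "(\<lambda>_. xbar, r0)" p] by (simp add: xr)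
    moreover have "\<kappa> * d (\<lambda>_. xbar, r0) p \<le> r0" using p(2) r by (simp add: xr)
    ultimately show ?thesis using \<kappa>(1) by (simp add: field_simps norm_minus_commute mult_left_mono order_trans)
  qed
  define z where "z i = y x i /\<^sub>R r" for i
  have yY: "y x' i \<in> Y" if "\<forall>i\<in>I. x' i \<in> W i" "i \<in> I" for x' i
    unfolding y_def using that W(2) aY I by (intro subspace_diff[OF Y(1)]) auto
  have zY: "z i \<in> Y" if "i \<in> J" for i
    unfolding z_def using that J xW by (intro subspace_scale[OF Y(1)] yY) auto
  have z1: "norm (z i) < 1" if "i \<in> J" for i
    using y_less[OF adm that] r by (simp add: z_def field_simps)
  \<comment> \<open>The arguments \<open>z i\<close> of the bumps lie in a ball of radius
    \<open>\<rho>0 < 1\<close>. The larger radius \<open>\<rho> < 1\<close> leaves room for moving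
    them while one index \<open>N\<close> still dominates all partial sums.\<close>
  define \<rho>0 where "\<rho>0 = Max (insert 0 ((\<lambda>i. norm (z i)) ` J))"
  have \<rho>0: "\<rho>0 < 1" "\<And>i. i \<in> J \<Longrightarrow> norm (z i) \<le> \<rho>0"
    using J(1) z1 by (auto simp: \<rho>0_def)
  define \<rho> where "\<rho> = (1 + \<rho>0) / 2"
  have \<rho>: "\<rho> < 1" "\<rho>0 < \<rho>" using \<rho>0(1) by (auto simp: \<rho>_def)
  obtain N where N: "\<And>M z. norm z \<le> \<rho> \<Longrightarrow> \<Phi> M z \<le> \<Phi> N z" using \<Phi>(5)[OF \<rho>(1)] by blast
  have "\<forall>i\<in>J. \<exists>(f :: 'a \<Rightarrow>\<^sub>L real) \<Lambda> K. \<Lambda> \<ge> 0 \<and> K \<ge> 0 \<and> (\<Phi> N (z i) > 0 \<longrightarrow> \<Lambda> > 0) \<and>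
       norm f \<le> \<Lambda> \<and> blinfun_apply f (z i) \<ge> \<Lambda> / 4 \<and>
       (\<forall>h\<in>Y. \<Phi> N (z i + h) \<le> \<Phi> N (z i) + blinfun_apply f h + \<kappa> * \<Lambda> * norm h + K * (norm h)\<^sup>2)"
    using \<Phi>(6) zY z1 by (simp add: less_imp_le)
  then obtain f :: "'i \<Rightarrow> 'a \<Rightarrow>\<^sub>L real" and L Ki where fLK: "\<forall>i\<in>J. L i \<ge> 0 \<and> Ki i \<ge> 0 \<and> (\<Phi> N (z i) > 0 \<longrightarrow> L i > 0) \<and>
       norm (f i) \<le> L i \<and> blinfun_apply (f i) (z i) \<ge> L i / 4 \<and>
       (\<forall>h\<in>Y. \<Phi> N (z i + h) \<le> \<Phi> N (z i) + blinfun_apply (f i) h + \<kappa> * L i * norm h + Ki i * (norm h)\<^sup>2)"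
    unfolding bchoice_iff by blast
  have f: "\<And>i. i \<in> J \<Longrightarrow> L i \<ge> 0" "\<And>i. i \<in> J \<Longrightarrow> Ki i \<ge> 0"
    "\<And>i. i \<in> J \<Longrightarrow> \<Phi> N (z i) > 0 \<Longrightarrow> L i > 0" "\<And>i. i \<in> J \<Longrightarrow> norm (f i) \<le> L i"
    "\<And>i. i \<in> J \<Longrightarrow> blinfun_apply (f i) (z i) \<ge> L i / 4"
    "\<And>i h. i \<in> J \<Longrightarrow> h \<in> Y \<Longrightarrow> \<Phi> N (z i + h) \<le> \<Phi> N (z i) + blinfun_apply (f i) h + \<kappa> * L i * norm h + Ki i * (norm h)\<^sup>2"
    using fLK by blast+
  define \<Lambda> where "\<Lambda> = sum L J"
  define K where "K = sum Ki J"
  have \<Lambda>0: "\<Lambda> \<ge> 0" and K0: "K \<ge> 0" unfolding \<Lambda>_def K_def using f by (auto intro: sum_nonneg)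
  have f_le: "blinfun_apply (f i) v \<le> L i * norm v" if "i \<in> J" for i v
  proof -
    have "\<bar>f i v\<bar> \<le> norm (f i) * norm v" using norm_blinfun[of "f i" v] by simp
    also have "\<dots> \<le> L i * norm v" by (intro mult_right_mono f(4) that) auto
    finally show ?thesis by simp
  qed
  \<comment> \<open>Here \<open>s\<close> bounds the movement of the points and \<open>t\<close> is
    the decrease of the scale. Since \<open>t > \<kappa> * s\<close>, the new pair is not
    admissible, so some partial sum exceeds 1/2; it is dominated by the sum with index
    \<open>N\<close>, which is expanded at \<open>z i\<close> and multiplied by the new scale
    \<open>r - t\<close>.\<close>
  have key: "(r - t) * (1/2 - (\<Sum>i\<in>J. \<Phi> N (z i))) < (\<Sum>i\<in>J. blinfun_apply (f i) (y x' i - y x i)) + t * \<Lambda> + \<kappa> * \<Lambda> * (s + t) + 2 * K * (s + t)\<^sup>2 / r"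
    if x': "\<forall>i\<in>I. x' i \<in> W i" and s: "(\<Sum>i\<in>I. norm (x i - x' i)) \<le> s" and y': "\<And>i. i \<in> J \<Longrightarrow> norm (y x' i - y x i) \<le> s"
      and t: "\<kappa> * s < t" "t \<le> r / 2" "s + t \<le> r * (\<rho> - \<rho>0) / 2" for x' s t
  proof -
    define r' where "r' = r - t"
    have s0: "s \<ge> 0" using s by (meson norm_ge_zero order_trans sum_nonneg)
    have t0: "t > 0" using t(1) s0 \<kappa>(1) by (meson less_imp_le mult_nonneg_nonneg order_le_less_trans)
    have r': "r' \<ge> r / 2" "r' > 0" using t r by (auto simp: r'_def)
    define k where "k i = y x' i /\<^sub>R r' - z i" for i
    have rk: "r' *\<^sub>R k i = (y x' i - y x i) + t *\<^sub>R z i" for i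
    proof -
      have "y x i = r *\<^sub>R z i" using r by (simp add: z_def)
      then show ?thesis using r' by (simp add: k_def r'_def scaleR_diff_right scaleR_diff_left)
    qed
    have rk_le: "r' * norm (k i) \<le> s + t" if "i \<in> J" for i
    proof -
      have "r' * norm (k i) = norm ((y x' i - y x i) + t *\<^sub>R z i)" using rk[of i] r' by (metis abs_of_pos norm_scaleR)
      also have "\<dots> \<le> norm (y x' i - y x i) + t * norm (z i)"
        using norm_triangle_ineq[of "y x' i - y x i" "t *\<^sub>R z i"] t0 by simp
      also have "\<dots> \<le> s + t * 1" using y'[OF that] z1[OF that] t0 by (intro add_mono mult_left_mono) auto
      finally show ?thesis by simp
    qed
    have "norm (k i) \<le> \<rho> - \<rho>0" if "i \<in> J" for i
    proof -
      have "r / 2 * norm (k i) \<le> r' * norm (k i)" using r' by (intro mult_right_mono) auto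
      also have "\<dots> \<le> r / 2 * (\<rho> - \<rho>0)" using rk_le[OF that] t(3) by simp
      finally show ?thesis using r by simp
    qed
    then have zk: "norm (y x' i /\<^sub>R r') \<le> \<rho>" if "i \<in> J" for i
      using that \<rho>0(2)[OF that] norm_triangle_ineq[of "z i" "k i"] by (force simp: k_def)
    have "\<not> adm x' r'"
    proof
      assume "adm x' r'"
      then have "r - \<kappa> * (\<Sum>i\<in>I. norm (x i - x' i)) \<le> r'" by (rule minimal)
      moreover have "\<kappa> * (\<Sum>i\<in>I. norm (x i - x' i)) \<le> \<kappa> * s" using s \<kappa>(1) by (intro mult_left_mono) auto
      ultimately show False using t(1) by (simp add: r'_def)
    qed
    then obtain M where "1/2 < (\<Sum>i\<in>J. \<Phi> M (y x' i /\<^sub>R r'))" using x' r' by (auto simp: adm_def not_le)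
    also have "\<dots> \<le> (\<Sum>i\<in>J. \<Phi> N (z i + k i))" using N zk by (intro sum_mono) (simp add: k_def)
    also have "\<dots> \<le> (\<Sum>i\<in>J. \<Phi> N (z i) + f i (k i) + \<kappa> * L i * norm (k i) + Ki i * (norm (k i))\<^sup>2)"
    proof (intro sum_mono f(6))
      fix i assume "i \<in> J"
      then show "k i \<in> Y" unfolding k_def using x' J zY by (intro subspace_diff[OF Y(1)] subspace_scale[OF Y(1)] yY) auto
    qed
    finally have "1/2 - (\<Sum>i\<in>J. \<Phi> N (z i)) < (\<Sum>i\<in>J. f i (k i) + \<kappa> * L i * norm (k i) + Ki i * (norm (k i))\<^sup>2)"
      by (simp add: sum.distrib)
    then have "r' * (1/2 - (\<Sum>i\<in>J. \<Phi> N (z i))) < r' * (\<Sum>i\<in>J. f i (k i) + \<kappa> * L i * norm (k i) + Ki i * (norm (k i))\<^sup>2)"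
      using r'(2) by (rule mult_strict_left_mono)
    also have "\<dots> = (\<Sum>i\<in>J. r' * (f i (k i) + \<kappa> * L i * norm (k i) + Ki i * (norm (k i))\<^sup>2))"
      by (rule sum_distrib_left)
    also have "\<dots> \<le> (\<Sum>i\<in>J. f i (y x' i - y x i) + t * L i + \<kappa> * L i * (s + t) + 2 * Ki i * (s + t)\<^sup>2 / r)"
    proof (rule sum_mono)
      fix i assume i: "i \<in> J"
      have "r' * f i (k i) = f i (r' *\<^sub>R k i)" by (simp add: blinfun.scaleR_right)
      also have "\<dots> = f i (y x' i - y x i) + t * f i (z i)"
        by (simp only: rk blinfun.add_right blinfun.scaleR_right real_scaleR_def)
      also have "t * f i (z i) \<le> t * (L i * 1)"
      proof -
        have "L i * norm (z i) \<le> L i * 1" using z1[OF i] f(1)[OF i] by (intro mult_left_mono) auto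
        then show ?thesis using f_le[OF i, of "z i"] t0 by (intro mult_left_mono) auto
      qed
      finally have 1: "r' * f i (k i) \<le> f i (y x' i - y x i) + t * L i" by simp
      have "\<kappa> * L i * (r' * norm (k i)) \<le> \<kappa> * L i * (s + t)"
        using \<kappa>(1) f(1)[OF i] by (intro mult_left_mono rk_le i) auto
      then have 2: "r' * (\<kappa> * L i * norm (k i)) \<le> \<kappa> * L i * (s + t)" by (simp add: mult_ac)
      have "(r' * norm (k i))\<^sup>2 \<le> (s + t)\<^sup>2" using r' by (intro power_mono rk_le i) auto
      then have "r' * (norm (k i))\<^sup>2 \<le> (s + t)\<^sup>2 / r'" using r' by (simp add: field_simps power2_eq_square)
      also have "\<dots> \<le> (s + t)\<^sup>2 / (r / 2)" using r r' by (intro divide_left_mono) auto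
      finally have "Ki i * (r' * (norm (k i))\<^sup>2) \<le> Ki i * ((s + t)\<^sup>2 / (r / 2))"
        using f(2)[OF i] by (intro mult_left_mono)
      then have 3: "r' * (Ki i * (norm (k i))\<^sup>2) \<le> 2 * Ki i * (s + t)\<^sup>2 / r" by (simp add: mult_ac)
      show "r' * (f i (k i) + \<kappa> * L i * norm (k i) + Ki i * (norm (k i))\<^sup>2) \<le> f i (y x' i - y x i) + t * L i + \<kappa> * L i * (s + t) + 2 * Ki i * (s + t)\<^sup>2 / r"
        unfolding distrib_left[of r'] using 1 2 3 by linarith
    qed
    also have "\<dots> = (\<Sum>i\<in>J. f i (y x' i - y x i)) + t * \<Lambda> + \<kappa> * \<Lambda> * (s + t) + 2 * K * (s + t)\<^sup>2 / r"
      by (simp add: sum.distrib \<Lambda>_def K_def sum_distrib_left sum_distrib_right sum_divide_distrib)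
    finally show ?thesis by (simp only: r'_def)
  qed
  define \<tau> where "\<tau> = min (r / 2) (r * (\<rho> - \<rho>0) / 2)"
  have \<tau>: "\<tau> > 0" "\<tau> \<le> r / 2" "\<tau> \<le> r * (\<rho> - \<rho>0) / 2" using r \<rho> by (auto simp: \<tau>_def)
  have \<Lambda>: "\<Lambda> > 0"
  proof (rule ccontr)
    assume "\<not> ?thesis"
    then have \<Lambda>z: "\<Lambda> = 0" using \<Lambda>0 by simp
    then have "L i = 0" if "i \<in> J" for i
      using that J(1) f(1) unfolding \<Lambda>_def by (simp add: sum_nonneg_eq_0_iff)
    then have \<Phi>z: "\<Phi> N (z i) = 0" if "i \<in> J" for i using f(3)[OF that] \<Phi>(2)[of N "z i"] that by force
    \<comment> \<open>If \<open>\<Lambda> = 0\<close>, all bumps vanish at \<open>z i\<close> and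
      the budget 1/2 is untouched. With the points fixed, a decrease \<open>t\<close> this small has
      a quadratic term too small to use up the budget, contradicting \<open>key\<close>.\<close>
    define t where "t = min \<tau> (min 1 (r\<^sup>2 / (8 * K + 8)))"
    have t: "t > 0" "t \<le> \<tau>" "t \<le> 1" "t \<le> r\<^sup>2 / (8 * K + 8)"
      using \<tau> r K0 by (auto simp: t_def intro!: divide_pos_pos)
    have "(r - t) * (1/2 - (\<Sum>i\<in>J. \<Phi> N (z i))) < (\<Sum>i\<in>J. blinfun_apply (f i) (y x i - y x i)) + t * \<Lambda> + \<kappa> * \<Lambda> * (0 + t) + 2 * K * (0 + t)\<^sup>2 / r"
      using t \<tau> xW by (intro key) auto
    then have lt: "(r - t) / 2 < 2 * K * t\<^sup>2 / r" by (simp add: \<Phi>z \<Lambda>z)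
    have "t * (8 * K + 8) \<le> r\<^sup>2" using t(4) K0 by (simp add: field_simps)
    moreover have "8 * K * t\<^sup>2 \<le> 8 * K * t"
      using t K0 by (intro mult_left_mono) (auto simp: power2_eq_square mult_le_one mult_left_le)
    ultimately have "8 * K * t\<^sup>2 \<le> r\<^sup>2" using t(1) by (simp add: algebra_simps)
    then have "2 * K * t\<^sup>2 / r \<le> r / 4" using r by (simp add: field_simps power2_eq_square)
    moreover have "(r - t) / 2 \<ge> r / 4" using t \<tau> by simp
    ultimately show False using lt by linarith
  qed
  \<comment> \<open>Below this threshold the quadratic remainder in \<open>key\<close> for
    \<open>t = 2 * \<kappa> * s\<close> is at most \<open>\<kappa> * \<Lambda> * s\<close>.\<close>
  define s0 where "s0 = min (\<tau> / 2) (\<kappa> * \<Lambda> * r / (2 * K * (1 + 2 * \<kappa>)\<^sup>2 + 1))"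
  have den: "2 * K * (1 + 2 * \<kappa>)\<^sup>2 + 1 > 0" using K0 by (intro add_nonneg_pos) auto
  have s0: "s0 > 0" using \<tau> \<kappa> \<Lambda> r den by (auto simp: s0_def intro!: divide_pos_pos)
  have main: "- (5 * \<kappa> * \<Lambda> * s) \<le> (\<Sum>i\<in>J. blinfun_apply (f i) (y x' i - y x i))"
    if x': "\<forall>i\<in>I. x' i \<in> W i" and s: "(\<Sum>i\<in>I. norm (x i - x' i)) \<le> s" and y': "\<And>i. i \<in> J \<Longrightarrow> norm (y x' i - y x i) \<le> s"
      and s': "0 < s" "s < s0" for x' s
  proof -
    have "\<kappa> * s \<le> 1/4 * s" using \<kappa> s' by (intro mult_right_mono) auto
    moreover have "s < \<tau> / 2" using s' by (simp add: s0_def)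
    ultimately have A: "2 * \<kappa> * s \<le> \<tau>" "s + 2 * \<kappa> * s \<le> \<tau>" using s' by linarith+
    \<comment> \<open>Here \<open>t = 2 * \<kappa> * s\<close>. In multiples of
      \<open>\<kappa> * \<Lambda> * s\<close>, the loss is 2 from the scale, at most 2 from the
      error of the derivative and at most 1 from the remainder: this is the factor 5.\<close>
    have "(r - 2 * \<kappa> * s) * (1/2 - (\<Sum>i\<in>J. \<Phi> N (z i))) < (\<Sum>i\<in>J. blinfun_apply (f i) (y x' i - y x i)) + 2 * \<kappa> * s * \<Lambda> + \<kappa> * \<Lambda> * (s + 2 * \<kappa> * s) + 2 * K * (s + 2 * \<kappa> * s)\<^sup>2 / r"
      using A \<tau> \<kappa> s' by (intro key x' s y') auto
    moreover have "0 \<le> (r - 2 * \<kappa> * s) * (1/2 - (\<Sum>i\<in>J. \<Phi> N (z i)))"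
    proof (rule mult_nonneg_nonneg)
      show "0 \<le> 1/2 - (\<Sum>i\<in>J. \<Phi> N (z i))" using adm by (simp add: adm_def z_def)
    qed (use A \<tau> r in linarith)
    moreover have "2 * K * (s + 2 * \<kappa> * s)\<^sup>2 / r \<le> \<kappa> * \<Lambda> * s"
    proof -
      have "s * (2 * K * (1 + 2 * \<kappa>)\<^sup>2 + 1) \<le> \<kappa> * \<Lambda> * r"
        using s'(2) den by (simp add: s0_def pos_less_divide_eq less_imp_le)
      then have "s * (2 * K * (1 + 2 * \<kappa>)\<^sup>2) \<le> \<kappa> * \<Lambda> * r" using s'(1) by (simp add: distrib_left)
      then have "s * (s * (2 * K * (1 + 2 * \<kappa>)\<^sup>2)) \<le> s * (\<kappa> * \<Lambda> * r)" using s'(1) by (intro mult_left_mono) auto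
      moreover have "2 * K * (s + 2 * \<kappa> * s)\<^sup>2 = s * (s * (2 * K * (1 + 2 * \<kappa>)\<^sup>2))"
        by (simp add: power2_eq_square algebra_simps)
      ultimately have "2 * K * (s + 2 * \<kappa> * s)\<^sup>2 \<le> s * (\<kappa> * \<Lambda> * r)" by (simp only:)
      then show ?thesis using r by (simp add: pos_divide_le_eq mult_ac)
    qed
    moreover have "\<kappa> * \<Lambda> * (2 * \<kappa> * s) \<le> \<kappa> * \<Lambda> * s"
      using \<kappa> \<Lambda> s' by (intro mult_left_mono) auto
    ultimately show ?thesis by (simp add: algebra_simps)
  qed
  \<comment> \<open>Moving point \<open>i\<close> of \<open>J\<close> changes only its own
    difference, while moving point \<open>i0\<close> changes all of them in the opposite direction.
    Hence the signs, and the sum 0.\<close>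
  define xs where "xs i = (if i = i0 then (1 / \<Lambda>) *\<^sub>R (\<Sum>j\<in>J. f j) else - ((1 / \<Lambda>) *\<^sub>R f i))" for i
  have xsJ: "xs i = - ((1 / \<Lambda>) *\<^sub>R f i)" if "i \<in> J" for i using that J(3) by (auto simp: xs_def)
  have xs0: "xs i0 = (1 / \<Lambda>) *\<^sub>R (\<Sum>j\<in>J. f j)" by (simp add: xs_def)
  define e where "e i = (if i = i0 then 0 else - z i)" for i
  have eJ: "e i = - z i" if "i \<in> J" for i using that J(3) by (auto simp: e_def)
  show ?thesis
  proof (rule that)
    show "x i \<in> W i" "norm (x i - xbar) \<le> r0 / \<kappa>" if "i \<in> I" for i
      using xW close that by auto
    show "e i \<in> Y" if "i \<in> I" for i
      using that zY subspace_0[OF Y(1)] subspace_neg[OF Y(1)] by (auto simp: e_def J_def)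
    show "norm (e i) \<le> 1" if "i \<in> I" for i
      using that z1 by (auto simp: e_def J_def less_imp_le)
    show "(\<Sum>i\<in>I. xs i) = 0"
      using J by (simp add: xs0 xsJ scaleR_sum_right sum_negf)
    show "norm (xs i) \<le> 1" if "i \<in> I" for i
    proof (cases "i = i0")
      case True
      have "norm (\<Sum>j\<in>J. f j) \<le> \<Lambda>" unfolding \<Lambda>_def by (intro sum_norm_le f(4))
      then show ?thesis using True \<Lambda> by (simp add: xs0)
    next
      case False
      then have "i \<in> J" using that by (simp add: J_def)
      moreover have "L i \<le> \<Lambda>" unfolding \<Lambda>_def using J f(1) \<open>i \<in> J\<close> by (intro member_le_sum) auto
      ultimately have "norm (f i) \<le> \<Lambda>" using f(4)[of i] by linarith
      then show ?thesis using \<open>i \<in> J\<close> \<Lambda> by (simp add: xsJ)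
    qed
    have "(\<Sum>i\<in>I. blinfun_apply (xs i) (e i)) = (\<Sum>i\<in>J. f i (z i) / \<Lambda>)"
      using J by (simp add: e_def[of i0] eJ xsJ blinfun.minus_left blinfun.minus_right blinfun.scaleR_left)
    also have "\<dots> \<ge> (\<Sum>i\<in>J. (L i / 4) / \<Lambda>)"
      using f(5) \<Lambda> by (intro sum_mono divide_right_mono) auto
    also have "(\<Sum>i\<in>J. (L i / 4) / \<Lambda>) = 1/4"
      using \<Lambda> by (simp add: sum_divide_distrib[symmetric] \<Lambda>_def)
    finally show "(\<Sum>i\<in>I. blinfun_apply (xs i) (e i)) \<ge> 1/4" .
    show "s0 > 0" by (rule s0)
    fix i \<omega> assume i: "i \<in> I" and \<omega>: "\<omega> \<in> W i" "norm (\<omega> - x i) < s0"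
    show "blinfun_apply (xs i) (\<omega> - x i) \<le> 5 * \<kappa> * norm (\<omega> - x i)"
    proof (cases "\<omega> = x i")
      case False
      \<comment> \<open>Only one point moves. In both cases below the sum of the derivatives is then
        \<open>- \<Lambda> * xs i (\<omega> - x i)\<close>, to which \<open>main\<close>
        applies.\<close>
      define x' where "x' = x(i := \<omega>)"
      have x'W: "\<forall>j\<in>I. x' j \<in> W j" using xW \<omega>(1) by (auto simp: x'_def)
      have "(\<Sum>j\<in>I. norm (x j - x' j)) = (\<Sum>j\<in>I. if j = i then norm (\<omega> - x i) else 0)"
        by (intro sum.cong) (auto simp: x'_def norm_minus_commute)
      then have s: "(\<Sum>j\<in>I. norm (x j - x' j)) \<le> norm (\<omega> - x i)" using I i by simp
      have "(\<Sum>j\<in>J. f j (y x' j - y x j)) = - \<Lambda> * xs i (\<omega> - x i) \<and> (\<forall>j\<in>J. norm (y x' j - y x j) \<le> norm (\<omega> - x i))"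
      proof (cases "i = i0")
        case True
        then have "y x' j - y x j = - (\<omega> - x i)" if "j \<in> J" for j
          using that J(3) by (auto simp: y_def x'_def)
        then show ?thesis using True \<Lambda>
          by (simp add: xs0 blinfun.scaleR_left blinfun.sum_left blinfun.minus_right sum_negf del: minus_diff_eq)
      next
        case False
        then have "y x' j - y x j = (if j = i then \<omega> - x i else 0)" if "j \<in> J" for j
          using that J(3) by (auto simp: y_def x'_def)
        moreover have iJ: "i \<in> J" using False i by (simp add: J_def)
        moreover have "(\<Sum>j\<in>J. f j (if j = i then \<omega> - x i else 0)) = (\<Sum>j\<in>J. if j = i then f i (\<omega> - x i) else 0)"
          by (intro sum.cong) auto
        ultimately show ?thesis using \<Lambda> J(1)
          by (simp add: xsJ blinfun.scaleR_left blinfun.minus_left)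
      qed
      then have "- (5 * \<kappa> * \<Lambda> * norm (\<omega> - x i)) \<le> - \<Lambda> * xs i (\<omega> - x i)"
        using main[OF x'W s] \<omega>(2) False by auto
      then have "\<Lambda> * xs i (\<omega> - x i) \<le> \<Lambda> * (5 * \<kappa> * norm (\<omega> - x i))" by (simp add: mult_ac)
      then show ?thesis using \<Lambda> by simp
    qed simp
  qed
qed

theorem theorem6p3:
  fixes \<Omega> :: "nat \<Rightarrow> 'a::banach set" and xbar :: 'a and n :: nat and \<epsilon> :: real
  assumes "asplund_space TYPE('a)"
    and "extremal_system n \<Omega> xbar"
    and "\<And>i. i \<in> {1..n} \<Longrightarrow> locally_closed_around (\<Omega> i) xbar"
    and "\<epsilon> > 0"
  shows "\<exists>(x :: nat \<Rightarrow> 'a) (xs :: nat \<Rightarrow> 'a \<Rightarrow>\<^sub>L real).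
    (\<forall>i\<in>{1..n}. x i \<in> \<Omega> i \<and> norm (x i - xbar) \<le> \<epsilon>) \<and>
    (\<Sum>i=1..n. xs i) = 0 \<and>
    (\<Sum>i=1..n. norm (xs i)) = 1 \<and>
    (\<forall>i\<in>{1..n}. \<forall>\<xi>>\<epsilon>. local_stationary_trap (blinfun_apply (xs i)) (\<Omega> i) (x i) \<xi>)"
proof -
  define I where "I = {1..n}"
  have fin: "finite I" by (simp add: I_def)
  obtain V and a :: "nat \<Rightarrow> nat \<Rightarrow> 'a" where V: "xbar \<in> interior V" and a: "\<And>i. i \<in> I \<Longrightarrow> a i \<longlonglongrightarrow> 0"
    and empty: "\<forall>\<^sub>F k in sequentially. (\<Inter>i\<in>I. (\<lambda>x. x - a i k) ` \<Omega> i) \<inter> V = {}"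
    and xbar: "\<And>i. i \<in> I \<Longrightarrow> xbar \<in> \<Omega> i"
    using assms(2) unfolding extremal_system_def I_def by blast
  \<comment> \<open>An empty intersection is the whole space, so \<open>n = 0\<close> would force
    \<open>V\<close> to be empty.\<close>
  have "n \<noteq> 0"
  proof
    assume "n = 0"
    then have "V = {}" using empty by (simp add: I_def)
    then show False using V by simp
  qed
  then have n: "n \<in> I" by (simp add: I_def)
  have "\<forall>i\<in>I. \<exists>U. xbar \<in> interior U \<and> closed (\<Omega> i \<inter> U)"
    using assms(3) by (auto simp: locally_closed_around_def I_def)
  then obtain U where U: "\<And>i. i \<in> I \<Longrightarrow> xbar \<in> interior (U i)" "\<And>i. i \<in> I \<Longrightarrow> closed (\<Omega> i \<inter> U i)"
    by metis
  have "open (interior V \<inter> (\<Inter>i\<in>I. interior (U i)))" using fin by (intro open_Int open_INT) auto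
  moreover have "xbar \<in> interior V \<inter> (\<Inter>i\<in>I. interior (U i))" using V U by blast
  ultimately have "\<exists>r>0. cball xbar r \<subseteq> interior V \<inter> (\<Inter>i\<in>I. interior (U i))"
    unfolding open_contains_cball by (rule bspec)
  then obtain \<rho>1 where \<rho>1: "\<rho>1 > 0" "cball xbar \<rho>1 \<subseteq> interior V \<inter> (\<Inter>i\<in>I. interior (U i))"
    by auto
  \<comment> \<open>Points within \<open>\<rho>\<close> of \<open>xbar\<close>, shifted by less than
    \<open>\<rho>\<close>, stay in the ball of radius \<open>2 * \<rho>\<close> inside
    \<open>V\<close>.\<close>
  define \<rho> where "\<rho> = min (\<rho>1 / 2) \<epsilon>"
  have \<rho>: "\<rho> > 0" "2 * \<rho> \<le> \<rho>1" "\<rho> \<le> \<epsilon>" using \<rho>1 assms(4) by (auto simp: \<rho>_def)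
  have "cball xbar (2 * \<rho>) \<subseteq> cball xbar \<rho>1" using \<rho> by auto
  also have "\<dots> \<subseteq> interior V" using \<rho>1(2) by blast
  finally have ballV: "cball xbar (2 * \<rho>) \<subseteq> V" using interior_subset by (rule subset_trans)
  have ballU: "cball xbar \<rho> \<subseteq> U i" if "i \<in> I" for i
  proof -
    have "cball xbar \<rho> \<subseteq> cball xbar \<rho>1" using \<rho> by auto
    also have "\<dots> \<subseteq> interior (U i)" using \<rho>1(2) that by blast
    finally show ?thesis using interior_subset by (rule subset_trans)
  qed
  \<comment> \<open>The bump needs \<open>\<kappa> \<le> 1/4\<close>; the final normalization
    multiplies the error \<open>5 * \<kappa>\<close> by at most 8.\<close>
  define \<kappa> where "\<kappa> = min (1/4) (\<epsilon> / 40)"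
  have \<kappa>: "\<kappa> > 0" "\<kappa> \<le> 1/4" "8 * (5 * \<kappa>) \<le> \<epsilon>" "5 * \<kappa> \<ge> 0" using assms(4) by (auto simp: \<kappa>_def)
  \<comment> \<open>The subspace must contain the base point and all shifts for the extremality to
    survive in it.\<close>
  define S where "S = insert xbar (\<Union>i\<in>I. range (a i))"
  have S: "countable S" unfolding S_def using fin by (intro countable_insert countable_UN) (auto intro: countable_finite)
  show ?thesis
  proof (rule separable_reduction[OF fin \<kappa>(4) S, of \<Omega>])
    fix Y
    assume Y: "closed Y" "subspace Y" "separable_space (top_of_set Y)" "S \<subseteq> Y"
      and reduce: "\<And>x e \<delta>' \<delta> c' c v T l. \<forall>i\<in>I. x i \<in> Y \<and> e i \<in> Y \<Longrightarrow> \<delta>' < \<delta> \<Longrightarrow> c' < c \<Longrightarrow>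
        feasible I x \<delta>' T l \<Longrightarrow> \<forall>i\<in>I. T i \<subseteq> \<Omega> i \<Longrightarrow> normal_gap I (5 * \<kappa>) x e v T l < c' \<Longrightarrow>
        \<exists>v T l. feasible I x \<delta> T l \<and> (\<forall>i\<in>I. T i \<subseteq> \<Omega> i \<inter> Y) \<and> normal_gap I (5 * \<kappa>) x e v T l < c"
    have dual: "separable_space (Metric_space.mtopology (dual_on Y) (dual_dist Y))"
      using assms(1) Y by (auto simp: asplund_space_def)
    \<comment> \<open>Chosen so that the distance bound \<open>r0 / \<kappa>\<close> is half of
      \<open>\<rho>\<close>; the other half is for the neighborhoods of the points found.\<close>
    define r0 where "r0 = \<kappa> * \<rho> / 2"
    have r0: "r0 > 0" "r0 / \<kappa> = \<rho> / 2" using \<kappa> \<rho> by (auto simp: r0_def)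
    have "\<forall>\<^sub>F k in sequentially. \<forall>i\<in>I. norm (a i k) < min (r0 / 4) \<rho>"
      unfolding eventually_ball_finite_distrib[OF fin]
    proof
      fix i assume "i \<in> I"
      show "\<forall>\<^sub>F k in sequentially. norm (a i k) < min (r0 / 4) \<rho>"
        using tendstoD[OF a[OF \<open>i \<in> I\<close>], of "min (r0 / 4) \<rho>"] r0(1) \<rho>(1) by simp
    qed
    with empty have "\<forall>\<^sub>F k in sequentially. (\<forall>i\<in>I. norm (a i k) < min (r0 / 4) \<rho>) \<and> (\<Inter>i\<in>I. (\<lambda>x. x - a i k) ` \<Omega> i) \<inter> V = {}"
      by eventually_elim simp
    from eventually_happens'[OF sequentially_bot this]
    obtain k where ak: "\<forall>i\<in>I. norm (a i k) < min (r0 / 4) \<rho>"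
      and k: "(\<Inter>i\<in>I. (\<lambda>x. x - a i k) ` \<Omega> i) \<inter> V = {}"
      by (elim exE conjE)
    have small: "norm (a i k) < min (r0 / 4) \<rho>" if "i \<in> I" for i using ak that by (rule bspec)
    define W where "W i = (\<Omega> i \<inter> U i) \<inter> cball xbar \<rho> \<inter> Y" for i
    have Wiff: "\<omega> \<in> W i \<longleftrightarrow> \<omega> \<in> \<Omega> i \<and> norm (\<omega> - xbar) \<le> \<rho> \<and> \<omega> \<in> Y" if "i \<in> I" for i \<omega>
      using ballU[OF that] by (auto simp: W_def dist_norm norm_minus_commute)
    have Wclosed: "closed (W i)" if "i \<in> I" for i
      unfolding W_def by (rule closed_Int[OF closed_Int[OF U(2)[OF that] closed_cball] Y(1)])
    have apart: "\<exists>i\<in>I. x i - a i k \<noteq> x n - a n k" if x: "\<forall>i\<in>I. x i \<in> W i" for x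
    proof (rule ccontr)
      assume "\<not> ?thesis"
      then have eq: "x n - a n k = x i - a i k" if "i \<in> I" for i using that by auto
      have "x n - a n k \<in> (\<Inter>i\<in>I. (\<lambda>x. x - a i k) ` \<Omega> i)"
        using eq x Wiff by blast
      moreover have "x n - a n k \<in> V"
      proof -
        have "norm (x n - xbar) \<le> \<rho>" "norm (a n k) \<le> \<rho>" using x n Wiff small[OF n] by auto
        then have "norm (x n - a n k - xbar) \<le> 2 * \<rho>"
          using norm_triangle_ineq4[of "x n - xbar" "a n k"] by (simp add: algebra_simps)
        then show ?thesis using ballV by (auto simp: dist_norm norm_minus_commute)
      qed
      ultimately show False using k by blast
    qed
    have aY: "a i k \<in> Y" if "i \<in> I" for i using that Y(4) by (auto simp: S_def)
    have WY: "W i \<subseteq> Y" for i by (auto simp: W_def)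
    have xW: "xbar \<in> W i" if "i \<in> I" for i using that Wiff xbar Y(4) \<rho> by (auto simp: S_def)
    have r0a: "2 * norm (a i k - a n k) \<le> r0" if "i \<in> I" for i
      using norm_triangle_ineq4[of "a i k" "a n k"] small[OF that] small[OF n] by simp
    \<comment> \<open>These functionals are normal only to the traces of the sets on
      \<open>Y\<close>. They serve to bound the gap from below and are replaced afterwards.\<close>
    obtain x e and xs :: "nat \<Rightarrow> 'a \<Rightarrow>\<^sub>L real" and \<delta> where
      x: "\<And>i. i \<in> I \<Longrightarrow> x i \<in> W i" "\<And>i. i \<in> I \<Longrightarrow> norm (x i - xbar) \<le> r0 / \<kappa>"
      and e: "\<And>i. i \<in> I \<Longrightarrow> e i \<in> Y" "\<And>i. i \<in> I \<Longrightarrow> norm (e i) \<le> 1"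
      and xs: "(\<Sum>i\<in>I. xs i) = 0" "\<And>i. i \<in> I \<Longrightarrow> norm (xs i) \<le> 1" "(\<Sum>i\<in>I. blinfun_apply (xs i) (e i)) \<ge> 1/4"
      and \<delta>: "\<delta> > 0"
      and normal: "\<And>i \<omega>. i \<in> I \<Longrightarrow> \<omega> \<in> W i \<Longrightarrow> norm (\<omega> - x i) < \<delta> \<Longrightarrow>
         blinfun_apply (xs i) (\<omega> - x i) \<le> 5 * \<kappa> * norm (\<omega> - x i)"
      using extremal_normals_separable_dual[where W = W and a = "\<lambda>i. a i k", OF fin n Y(2) dual Wclosed WY xW aY apart r0(1) r0a \<kappa>(1,2)]
      by blast
    define \<delta>1 where "\<delta>1 = min \<delta> (\<rho> / 2)"
    have \<delta>1: "\<delta>1 > 0" "\<delta>1 \<le> \<delta>" "\<delta>1 \<le> \<rho> / 2" using \<delta> \<rho> by (auto simp: \<delta>1_def)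
    \<comment> \<open>Halving the radius and the bound 1/4 provides the room that
      \<open>reduce\<close> consumes: a smaller gap on the whole sets would yield a gap below 1/4 on
      the traces, against weak duality.\<close>
    have gap: "normal_gap I (5 * \<kappa>) x e v T l \<ge> 1/8"
      if f: "feasible I x (\<delta>1 / 2) T l" and T: "\<forall>i\<in>I. T i \<subseteq> \<Omega> i" for v T l
    proof (rule ccontr)
      assume "\<not> ?thesis"
      then have small: "normal_gap I (5 * \<kappa>) x e v T l < 1/8" by simp
      have "\<exists>v T l. feasible I x \<delta>1 T l \<and> (\<forall>i\<in>I. T i \<subseteq> \<Omega> i \<inter> Y) \<and> normal_gap I (5 * \<kappa>) x e v T l < 1/4"
        using x(1) e(1) WY \<delta>1(1) by (intro reduce[OF _ _ _ f T small]) auto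
      then obtain v T l where f': "feasible I x \<delta>1 T l" and T': "\<forall>i\<in>I. T i \<subseteq> \<Omega> i \<inter> Y"
        and lt: "normal_gap I (5 * \<kappa>) x e v T l < 1/4" by blast
      have "(\<Sum>i\<in>I. blinfun_apply (xs i) (e i)) \<le> normal_gap I (5 * \<kappa>) x e v T l"
      proof (rule normal_gap_ge_pairing[OF f' xs(1,2)])
        fix i \<omega> assume i: "i \<in> I" and \<omega>: "\<omega> \<in> T i"
        have d: "norm (\<omega> - x i) < \<delta>1" using f' i \<omega> by (auto simp: feasible_def)
        have "norm (\<omega> - xbar) \<le> \<rho>"
          using norm_triangle_ineq[of "\<omega> - x i" "x i - xbar"] d \<delta>1(3) x(2)[OF i] r0(2) by simp
        then have "\<omega> \<in> W i" using T' i \<omega> by (auto simp: Wiff)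
        then show "blinfun_apply (xs i) (\<omega> - x i) \<le> 5 * \<kappa> * norm (\<omega> - x i)"
          using d \<delta>1 by (intro normal i) auto
      qed
      then show False using lt xs(3) by linarith
    qed
    obtain ys :: "nat \<Rightarrow> 'a \<Rightarrow>\<^sub>L real" where ys: "(\<Sum>i\<in>I. ys i) = 0" "(\<Sum>i\<in>I. blinfun_apply (ys i) (e i)) \<ge> 1/8"
      "\<And>i \<omega>. i \<in> I \<Longrightarrow> \<omega> \<in> \<Omega> i \<Longrightarrow> norm (\<omega> - x i) < \<delta>1 / 2 \<Longrightarrow> blinfun_apply (ys i) (\<omega> - x i) \<le> 5 * \<kappa> * norm (\<omega> - x i)"
      using normal_multipliers[OF fin \<kappa>(4) gap] by blast
    define M where "M = (\<Sum>i\<in>I. norm (ys i))"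
    have "(\<Sum>i\<in>I. blinfun_apply (ys i) (e i)) \<le> M"
      unfolding M_def
    proof (rule sum_mono)
      fix i assume "i \<in> I"
      have "\<bar>ys i (e i)\<bar> \<le> norm (ys i) * norm (e i)" using norm_blinfun[of "ys i" "e i"] by simp
      also have "\<dots> \<le> norm (ys i) * 1" using e(2)[OF \<open>i \<in> I\<close>] by (intro mult_left_mono) auto
      finally show "ys i (e i) \<le> norm (ys i)" by simp
    qed
    \<comment> \<open>Because \<open>e\<close> lies in the unit ball, the functionals cannot be
      small in total; dividing by \<open>M\<close> therefore enlarges the weight at most
      eightfold.\<close>
    then have M: "M \<ge> 1/8" using ys(2) by linarith
    define zs where "zs i = (1 / M) *\<^sub>R ys i" for i
    show ?thesis
      unfolding I_def[symmetric]
    proof (intro exI[of _ x] exI[of _ zs] conjI ballI allI impI)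
      fix i assume i: "i \<in> I"
      show xi: "x i \<in> \<Omega> i" using x(1)[OF i] by (simp add: Wiff[OF i])
      show "norm (x i - xbar) \<le> \<epsilon>" using x(2)[OF i] r0(2) \<rho> by simp
      fix \<xi> assume \<xi>: "\<xi> > \<epsilon>"
      \<comment> \<open>The same ball serves every \<open>\<xi> > \<epsilon>\<close>.\<close>
      have "blinfun_apply (zs i) \<omega> - \<xi> * norm (\<omega> - x i) \<le> blinfun_apply (zs i) (x i)"
        if \<omega>: "\<omega> \<in> ball (x i) (\<delta>1 / 2) \<inter> \<Omega> i" for \<omega>
      proof -
        have "ys i (\<omega> - x i) \<le> 5 * \<kappa> * norm (\<omega> - x i)"
          using \<omega> by (intro ys(3) i) (auto simp: dist_norm norm_minus_commute)
        also have "\<dots> \<le> (M * 8) * (5 * \<kappa>) * norm (\<omega> - x i)"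
          using M \<kappa>(1) by (intro mult_right_mono) auto
        also have "\<dots> = M * (8 * (5 * \<kappa>) * norm (\<omega> - x i))" by simp
        also have "\<dots> \<le> M * (\<xi> * norm (\<omega> - x i))"
          using M \<kappa>(3) \<xi> by (intro mult_left_mono mult_right_mono) auto
        finally have "zs i (\<omega> - x i) \<le> \<xi> * norm (\<omega> - x i)"
          using M by (simp add: zs_def blinfun.scaleR_left pos_divide_le_eq mult_ac)
        then show ?thesis by (simp add: blinfun.diff_right)
      qed
      then show "local_stationary_trap (blinfun_apply (zs i)) (\<Omega> i) (x i) \<xi>"
        unfolding local_stationary_trap_def using xi \<xi> assms(4) \<delta>1(1)
        by (intro conjI exI[of _ "ball (x i) (\<delta>1 / 2)"]) auto
    next
      show "(\<Sum>i\<in>I. zs i) = 0" using ys(1) by (simp add: zs_def scaleR_sum_right[symmetric])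
      have "(\<Sum>i\<in>I. norm (zs i)) = (\<Sum>i\<in>I. norm (ys i) / M)" using M by (simp add: zs_def)
      also have "\<dots> = M / M" unfolding M_def by (rule sum_divide_distrib[symmetric])
      finally show "(\<Sum>i\<in>I. norm (zs i)) = 1" using M by simp
    qed
  qed
qed

end
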